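(* Let $G$ be a finite simple undirected connected graph. (a) If the hyperbolicity of $G$ is at most $\delta$, then $ipco(G)\le 4\delta+3$. (b) If $G$ is a (theta, pyramid, prism)-free graph, then $ipco(G)\le 71$. (c) If $G$ is an outerstring graph, then $ipco(G)\le 95$.
   Context: All graphs are finite, simple, undirected and connected. The length of a path is its number of edges; a path is induced if no two non-consecutive vertices of it are adjacent. A path of $G$ is isometric if it is a shortest path in $G$ between its endpoints. An isometric path is $v$-rooted if $v$ is one of its endpoints. The isometric path complexity $ipco(G)$ is the minimum integer $k$ such that there exists a vertex $v\in V(G)$ satisfying: for every isometric path $P$ of $G$, the vertices of $P$ can be covered by $k$ many $v$-rooted isometric paths of $G$. Hyperbolicity: with $\mathsf d$ the shortest-path distance, $G$ is $\delta$-hyperbolic if for any four vertices $u,v,x,y$, the two larger of the three sums $\mathsf d(u,v)+\mathsf d(x,y)$, $\mathsf d(u,x)+\mathsf d(v,y)$, $\mathsf d(u,y)+\mathsf d(v,x)$ differ by at most $2\delta$. The hyperbolicity of $G$ is at most $\delta$ if $G$ is $\delta$-hyperbolic. A theta is a graph made of three internally vertex-disjoint induced paths $P_1=a\ldots b$, $P_2=a\ldots b$, $P_3=a\ldots b$ of lengths at least $2$, such that no edges exist between the paths except the three edges incident to $a$ and the three edges incident to $b$. A pyramid is a graph made of three induced paths $P_1=a\ldots b_1$, $P_2=a\ldots b_2$, $P_3=a\ldots b_3$ of lengths at least $1$, two of which have lengths at least $2$, vertex-disjoint except at $a$, such that $b_1b_2b_3$ is a triangle and no edges exist between the paths except those of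 the triangle and the three edges incident to $a$. A prism is a graph made of three vertex-disjoint induced paths $P_1=a_1\ldots b_1$, $P_2=a_2\ldots b_2$, $P_3=a_3\ldots b_3$ of lengths at least $1$, such that $a_1a_2a_3$ and $b_1b_2b_3$ are triangles and no edges exist between the paths except those of the two triangles. $G$ is (theta, pyramid, prism)-free if it has no induced subgraph isomorphic to a theta, a pyramid or a prism. A set of simple curves in the plane is grounded if there is a horizontal line containing one endpoint of each curve, all curves lying in one and the same closed half-plane bounded by this line. $G$ is an outerstring graph if there is a grounded collection $C$ of simple curves and a bijection between $V(G)$ and $C$ such that two curves of $C$ intersect if and only if the corresponding (distinct) vertices are adjacent in $G$. *)

theory Defs
  imports "HOL-Analysis.Analysis" "Graph_Theory.Graph_Theory"
begin

text \<open>Finite simple undirected graphs are the symmetric loop-free digraphs of locale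
  \<^locale>\<open>graph\<close>; paths are the vertex lists of \<^const>\<open>vpath\<close>, so a single vertex is a path
  of length 0.\<close>

definition gdist :: "('a, 'b) pre_digraph \<Rightarrow> 'a \<Rightarrow> 'a \<Rightarrow> nat" where
  "gdist G u v = (LEAST n. \<exists>p. vpath p G \<and> hd p = u \<and> last p = v \<and> vwalk_length p = n)"

definition isometric_path :: "('a, 'b) pre_digraph \<Rightarrow> 'a vwalk \<Rightarrow> bool" where
  "isometric_path G p \<longleftrightarrow> vpath p G \<and> vwalk_length p = gdist G (hd p) (last p)"

definition rooted :: "'a \<Rightarrow> 'a vwalk \<Rightarrow> bool" where
  "rooted v p \<longleftrightarrow> hd p = v \<or> last p = v"

definition rooted_coverable :: "('a, 'b) pre_digraph \<Rightarrow> 'a \<Rightarrow> nat \<Rightarrow> 'a set \<Rightarrow> bool" where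
  "rooted_coverable G v k S \<longleftrightarrow>
     (\<exists>Q. finite Q \<and> card Q \<le> k \<and> (\<forall>q\<in>Q. isometric_path G q \<and> rooted v q) \<and> S \<subseteq> (\<Union>q\<in>Q. set q))"

definition ipco :: "('a, 'b) pre_digraph \<Rightarrow> nat" where
  "ipco G = (LEAST k. \<exists>v\<in>verts G. \<forall>P. isometric_path G P \<longrightarrow> rooted_coverable G v k (set P))"

text \<open>The \<^const>\<open>Least\<close> in \<^const>\<open>gdist\<close> and \<^const>\<open>ipco\<close> is attained on connected graphs.\<close>

lemma gdist_attained:
  assumes "Digraph.graph G" "Digraph_Component.connected G" "u \<in> verts G" "v \<in> verts G"
  shows "\<exists>p. isometric_path G p \<and> hd p = u \<and> last p = v"
proof -
  interpret Digraph.graph G by fact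
  have "u \<rightarrow>\<^sup>*\<^bsub>G\<^esub> v"
    using symmetric_connected_imp_strongly_connected[OF sym_arcs assms(2)] assms(3,4)
    by (auto simp: strongly_connected_def)
  then have "\<exists>n p. vpath p G \<and> hd p = u \<and> last p = v \<and> vwalk_length p = n"
    using reachable_vpath_conv by blast
  from LeastI_ex[OF this] show ?thesis
    unfolding isometric_path_def gdist_def by auto
qed

lemma ipco_attained:
  assumes G: "Digraph.graph G" "Digraph_Component.connected G"
  shows "\<exists>v\<in>verts G. \<forall>P. isometric_path G P \<longrightarrow> rooted_coverable G v (ipco G) (set P)"
proof -
  interpret Digraph.graph G by fact
  obtain v where v: "v \<in> verts G"
    using G by (auto simp: connected_def strongly_connected_def)
  obtain q where q: "\<And>u. u \<in> verts G \<Longrightarrow> isometric_path G (q u) \<and> hd (q u) = v \<and> last (q u) = u"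
    using gdist_attained[OF G v] by metis
  have "rooted_coverable G v (card (verts G)) (set P)" if "isometric_path G P" for P
    unfolding rooted_coverable_def
  proof (intro exI conjI)
    show "finite (q ` verts G)" "card (q ` verts G) \<le> card (verts G)"
      by (simp_all add: card_image_le)
    show "\<forall>p\<in>q ` verts G. isometric_path G p \<and> rooted v p"
      using q by (auto simp: rooted_def)
    have "u \<in> set (q u)" if "u \<in> verts G" for u
    proof -
      have "q u \<noteq> []" "last (q u) = u"
        using q[OF that] by (auto simp: isometric_path_def vpath_def vwalk_def)
      then show ?thesis by (metis last_in_set)
    qed
    moreover have "set P \<subseteq> verts G"
      using \<open>isometric_path G P\<close> by (auto simp: isometric_path_def vpath_def vwalk_def)
    ultimately show "set P \<subseteq> (\<Union>p\<in>q ` verts G. set p)" by auto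
  qed
  then have "\<exists>k. \<exists>v\<in>verts G. \<forall>P. isometric_path G P \<longrightarrow> rooted_coverable G v k (set P)"
    using v by blast
  from LeastI_ex[OF this] show ?thesis unfolding ipco_def .
qed

text \<open>The two larger sums are the last two entries of the sorted list.\<close>

definition hyperbolic :: "real \<Rightarrow> ('a, 'b) pre_digraph \<Rightarrow> bool" where
  "hyperbolic \<delta> G \<longleftrightarrow>
     (\<forall>u\<in>verts G. \<forall>v\<in>verts G. \<forall>x\<in>verts G. \<forall>y\<in>verts G.
        let s = sort [gdist G u v + gdist G x y,
                      gdist G u x + gdist G v y,
                      gdist G u y + gdist G v x]
        in real (s ! 2) - real (s ! 1) \<le> 2 * \<delta>)"

definition induced_path :: "('a, 'b) pre_digraph \<Rightarrow> 'a vwalk \<Rightarrow> bool" where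
  "induced_path G p \<longleftrightarrow> vpath p G \<and>
     (\<forall>i j. i < length p \<and> j < length p \<and> i \<noteq> j \<and> j \<noteq> Suc i \<and> i \<noteq> Suc j \<longrightarrow> \<not> p ! i \<rightarrow>\<^bsub>G\<^esub> p ! j)"

definition path_edges :: "'a vwalk \<Rightarrow> ('a \<times> 'a) set" where
  "path_edges p = set (vwalk_arcs p) \<union> (set (vwalk_arcs p))\<inverse>"

definition triangle_edges :: "'a \<Rightarrow> 'a \<Rightarrow> 'a \<Rightarrow> ('a \<times> 'a) set" where
  "triangle_edges x y z = {(s, t). s \<in> {x, y, z} \<and> t \<in> {x, y, z} \<and> s \<noteq> t}"

text \<open>Below, the condition that the only edges between the paths are the listed ones is expressed
  by giving the whole edge set; the edges at \<open>a\<close> (and \<open>b\<close>, for a theta) are edges of the paths.\<close>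

definition theta :: "('a, 'b) pre_digraph \<Rightarrow> bool" where
  "theta H \<longleftrightarrow> Digraph.graph H \<and>
     (\<exists>a b P1 P2 P3.
        (\<forall>P\<in>{P1, P2, P3}. induced_path H P \<and> hd P = a \<and> last P = b \<and> vwalk_length P \<ge> 2) \<and>
        set P1 \<inter> set P2 = {a, b} \<and> set P1 \<inter> set P3 = {a, b} \<and> set P2 \<inter> set P3 = {a, b} \<and>
        verts H = set P1 \<union> set P2 \<union> set P3 \<and>
        arcs_ends H = path_edges P1 \<union> path_edges P2 \<union> path_edges P3)"

definition pyramid :: "('a, 'b) pre_digraph \<Rightarrow> bool" where
  "pyramid H \<longleftrightarrow> Digraph.graph H \<and>
     (\<exists>a b1 b2 b3 P1 P2 P3.
        (\<forall>P\<in>{P1, P2, P3}. induced_path H P \<and> hd P = a \<and> vwalk_length P \<ge> 1) \<and>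
        last P1 = b1 \<and> last P2 = b2 \<and> last P3 = b3 \<and>
        (vwalk_length P1 \<ge> 2 \<and> vwalk_length P2 \<ge> 2 \<or>
         vwalk_length P1 \<ge> 2 \<and> vwalk_length P3 \<ge> 2 \<or>
         vwalk_length P2 \<ge> 2 \<and> vwalk_length P3 \<ge> 2) \<and>
        set P1 \<inter> set P2 = {a} \<and> set P1 \<inter> set P3 = {a} \<and> set P2 \<inter> set P3 = {a} \<and>
        verts H = set P1 \<union> set P2 \<union> set P3 \<and>
        arcs_ends H = path_edges P1 \<union> path_edges P2 \<union> path_edges P3 \<union> triangle_edges b1 b2 b3)"

definition prism :: "('a, 'b) pre_digraph \<Rightarrow> bool" where
  "prism H \<longleftrightarrow> Digraph.graph H \<and>
     (\<exists>a1 a2 a3 b1 b2 b3 P1 P2 P3.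
        (\<forall>P\<in>{P1, P2, P3}. induced_path H P \<and> vwalk_length P \<ge> 1) \<and>
        hd P1 = a1 \<and> hd P2 = a2 \<and> hd P3 = a3 \<and> last P1 = b1 \<and> last P2 = b2 \<and> last P3 = b3 \<and>
        set P1 \<inter> set P2 = {} \<and> set P1 \<inter> set P3 = {} \<and> set P2 \<inter> set P3 = {} \<and>
        verts H = set P1 \<union> set P2 \<union> set P3 \<and>
        arcs_ends H = path_edges P1 \<union> path_edges P2 \<union> path_edges P3 \<union>
          triangle_edges a1 a2 a3 \<union> triangle_edges b1 b2 b3)"

text \<open>The three predicates are invariant under isomorphism, so no isomorphism is mentioned.\<close>

definition theta_pyramid_prism_free :: "('a, 'b) pre_digraph \<Rightarrow> bool" where
  "theta_pyramid_prism_free G \<longleftrightarrow>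
     \<not> (\<exists>H. induced_subgraph H G \<and> (theta H \<or> pyramid H \<or> prism H))"

text \<open>Curves are point sets; a simple curve with endpoints is the image of an \<^const>\<open>arc\<close>.\<close>

definition grounded :: "complex set set \<Rightarrow> bool" where
  "grounded C \<longleftrightarrow>
     (\<exists>c. (\<forall>S\<in>C. \<exists>g. arc g \<and> path_image g = S \<and> (Im (pathstart g) = c \<or> Im (pathfinish g) = c)) \<and>
          ((\<forall>S\<in>C. S \<subseteq> {z. Im z \<ge> c}) \<or> (\<forall>S\<in>C. S \<subseteq> {z. Im z \<le> c})))"

definition outerstring :: "('a, 'b) pre_digraph \<Rightarrow> bool" where
  "outerstring G \<longleftrightarrow>
     (\<exists>C f. grounded C \<and> bij_betw f (verts G) C \<and>
        (\<forall>u\<in>verts G. \<forall>v\<in>verts G. u \<noteq> v \<longrightarrow> (f u \<inter> f v \<noteq> {} \<longleftrightarrow> u \<rightarrow>\<^bsub>G\<^esub> v)))"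

end

theory Submission
  imports Defs
begin

text \<open>Fix any root \<open>v\<close>, an isometric path with vertices \<open>p i\<close>, and let \<open>f i\<close> be the distance of \<open>p i\<close> from \<open>v\<close>.
  Then \<open>f i + i\<close> is non-decreasing, \<open>f i - i\<close> is non-increasing, and a segment on which one of them
  is constant lies on a single rooted isometric path. Covering greedily by such segments, a path not covered
  by \<open>k\<close> rooted isometric paths has indices \<open>x 0 < \<dots> < x k\<close> along which both change strictly at every step.

  In a hyperbolic graph the four vertices \<open>v\<close>, \<open>p (x 0)\<close>, \<open>p (x K)\<close>, \<open>p (x (2 * K))\<close> bound \<open>K\<close>.

  In general, if \<open>k = 40\<close>, geodesics from \<open>p (x 0)\<close>, \<open>p (x 20)\<close> and \<open>p (x 40)\<close> to \<open>v\<close> touch the path only in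
  short disjoint zones, and the middle one leaves the path far from the two others. Shortest
  connections within their union give an induced theta, pyramid or prism with long paths. Such
  a graph is not outerstring either: the ground points of a vertex near one hub and of one inner vertex on each of the
  three paths would admit no interlacing pairing, since curves joining interlacing pairs intersect by the
  Fashoda theorem. Thus the complexity is at most 40 in both cases.\<close>

section \<open>Induced paths and hubs\<close>

text \<open>Induced paths over a bare adjacency relation, so that lists are cut and glued
  independently of a graph. The empty list is allowed because hubs and pieces of paths may be
  empty.\<close>

fun ipath :: "('a \<Rightarrow> 'a \<Rightarrow> bool) \<Rightarrow> 'a list \<Rightarrow> bool" where
  "ipath E [] \<longleftrightarrow> True"
| "ipath E (x # xs) \<longleftrightarrow> ipath E xs \<and> x \<notin> set xs \<and> (\<forall>y\<in>set xs. E x y \<longleftrightarrow> y = hd xs)"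

text \<open>Later cutting and gluing goes through this equivalence. If a factor is empty, the last
  condition is vacuous, so the values of \<open>last\<close> and \<open>hd\<close> on
  \<open>[]\<close> never matter.\<close>

lemma ipath_append:
  "ipath E (xs @ ys) \<longleftrightarrow> ipath E xs \<and> ipath E ys \<and> set xs \<inter> set ys = {} \<and>
     (\<forall>x\<in>set xs. \<forall>y\<in>set ys. E x y \<longleftrightarrow> x = last xs \<and> y = hd ys)"
proof (induction xs)
  case (Cons x xs)
  show ?case
  proof (cases xs)
    case (Cons a as)
    then show ?thesis unfolding append_Cons ipath.simps Cons.IH by auto
  qed auto
qed simp

lemma ipath_distinct: "ipath E p \<Longrightarrow> distinct p"
  by (induction p) auto

lemma ipath_successively: "ipath E p \<Longrightarrow> successively E p"
proof (induction p)
  case (Cons x p)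
  then show ?case by (cases p) auto
qed simp

lemma ipath_rev:
  assumes "symp E"
  shows "ipath E (rev p) \<longleftrightarrow> ipath E p"
proof (induction p)
  case (Cons x p)
  then show ?case
    using assms by (auto simp: ipath_append last_rev symp_def)
qed simp

lemma ipath_nth:
  assumes "symp E" "irreflp E"
  shows "ipath E p \<longleftrightarrow> distinct p \<and> (\<forall>i<length p. \<forall>j<length p. E (p ! i) (p ! j) \<longleftrightarrow> j = Suc i \<or> i = Suc j)"
proof (induction p)
  case (Cons x p)
  have *: "(\<forall>y\<in>set p. E x y \<longleftrightarrow> y = hd p) \<longleftrightarrow> (\<forall>j<length p. E x (p ! j) \<longleftrightarrow> j = 0)" if "distinct p"
  proof (cases "p = []")
    case False
    then show ?thesis
      using that by (auto simp: all_set_conv_all_nth hd_conv_nth nth_eq_iff_index_eq)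
  qed simp
  have sx: "E (p ! j) x = E x (p ! j)" "\<not> E x x" for j
    using assms by (auto simp: symp_def irreflp_def)
  show ?case
    unfolding ipath.simps Cons.IH
    using * by (auto simp: All_less_Suc2 sx) 
qed simp

text \<open>By induction on the walk: given an induced path \<open>q\<close> for the tail, the new
  vertex \<open>x\<close> is joined to its last neighbour on \<open>q\<close> and everything before
  that neighbour is dropped; an \<open>x\<close> in \<open>T\<close> or already on \<open>q\<close>
  only requires a cut. The result is shortest in the sense that it has no chord and meets
  \<open>T\<close> only at its end.\<close>

lemma shortest_ipath:
  assumes "symp E" "p \<noteq> []" "successively E p" "set p \<subseteq> K" "last p \<in> T"
  obtains q where "ipath E q" "q \<noteq> []" "set q \<subseteq> K" "hd q = hd p" "last q \<in> T" "set (butlast q) \<inter> T = {}"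
proof -
  have "\<exists>q. ipath E q \<and> q \<noteq> [] \<and> set q \<subseteq> K \<and> hd q = hd p \<and> last q \<in> T \<and> set (butlast q) \<inter> T = {}"
    using assms(2-)
  proof (induction p)
    case (Cons x p)
    show ?case
    proof (cases "x \<in> T")
      case True
      then show ?thesis using Cons.prems by (intro exI[of _ "[x]"]) auto
    next
      case xT: False
      then have p: "p \<noteq> []" "E x (hd p)" using Cons.prems by (auto simp: successively_Cons)
      then obtain q where q: "ipath E q" "q \<noteq> []" "set q \<subseteq> K" "hd q = hd p" "last q \<in> T" "set (butlast q) \<inter> T = {}"
        using Cons by (auto simp: successively_Cons)
      show ?thesis
      proof (cases "x \<in> set q")
        case True
        then obtain u w where "q = u @ x # w" by (auto simp: in_set_conv_decomp)
        then show ?thesis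
          using q by (intro exI[of _ "x # w"]) (auto simp: ipath_append butlast_append)
      next
        case False
        have "\<exists>y\<in>set q. E x y" using p q by (metis hd_in_set)
        then obtain u y w where w: "q = u @ y # w" "E x y" "\<forall>z\<in>set w. \<not> E x z"
          using split_list_last_prop[of q "E x"] by auto
        then show ?thesis
          using q False xT Cons.prems
          by (intro exI[of _ "x # y # w"]) (auto simp: ipath_append butlast_append)
      qed
    qed
  qed simp
  then show thesis using that by blast
qed

section \<open>Splitting a path at its contacts with a vertex\<close>

lemma contact_split:
  assumes "z \<in> set L" "Q z"
  obtains (single) L1 h L3 where "L = L1 @ h # L3" "Q h" "\<forall>z\<in>set L1 \<union> set L3. \<not> Q z"
  | (several) L1 a M b L3 where "L = (L1 @ [a]) @ M @ b # L3" "Q a" "Q b" "\<forall>z\<in>set L1 \<union> set L3. \<not> Q z"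
proof -
  obtain L1 a R where L: "L = L1 @ a # R" "Q a" "\<forall>z\<in>set L1. \<not> Q z"
    using assms split_list_first_prop[of L Q] by auto
  show thesis
  proof (cases "\<exists>z\<in>set R. Q z")
    case True
    then obtain M b L3 where R: "R = M @ b # L3" "Q b" "\<forall>z\<in>set L3. \<not> Q z"
      using split_list_last_prop[of R Q] by auto
    show thesis by (rule several[of L1 a M b L3]) (use L R in auto)
  next
    case False
    show thesis by (rule single[of L1 a R]) (use L False in auto)
  qed
qed

text \<open>Were \<open>S1\<close> longer than \<open>L1\<close>, it would contain the entry
  \<open>z\<close> at position \<open>length L1\<close>. This is how contact-free stretches survive
  a split.\<close>

lemma length_le_if_hit:
  assumes "L1 @ z # R = S1 @ S2" "z \<notin> set S1"
  shows "length S1 \<le> length L1"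
proof (rule ccontr)
  assume "\<not> length S1 \<le> length L1"
  then have *: "length L1 < length S1" by simp
  have "z = (L1 @ z # R) ! length L1" by simp
  also have "\<dots> = S1 ! length L1" using * by (simp add: assms(1) nth_append)
  finally show False using * assms(2) by (metis nth_mem)
qed

text \<open>The contacts of \<open>last X\<close> with \<open>L\<close> decide the hub. A single
  contact is itself the hub; two consecutive ones form a triangle with \<open>last X\<close> and
  leave the hub empty; otherwise \<open>last X\<close> becomes the hub, and the stretch
  \<open>M\<close> strictly between the outermost contacts is discarded. Since \<open>S1\<close> and
  \<open>S3\<close> contain no contact, \<open>L1\<close> and \<open>L3\<close> are at least as
  long.\<close>

lemma split_hub:
  assumes E: "symp E" "irreflp E"
    and L: "ipath E L" and X: "ipath E X" "2 \<le> length X"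
    and disj: "set L \<inter> set X = {}"
    and only: "\<forall>x\<in>set X. \<forall>z\<in>set L. E x z \<longrightarrow> x = last X"
    and ex: "\<exists>z\<in>set L. E (last X) z"
    and S: "L = S1 @ S2 @ S3" "\<forall>z\<in>set S1 \<union> set S3. \<not> E (last X) z"
  obtains H L1 M L3 X1 where "L = L1 @ M @ L3" "length H \<le> 1"
    "ipath E (X1 @ H)" "ipath E (L1 @ H)" "ipath E (H @ L3)"
    "X1 = X \<and> H = M \<or> X1 = butlast X \<and> H = [last X] \<and> M \<noteq> [] \<and> L1 \<noteq> [] \<and> L3 \<noteq> []"
    "M = [] \<longrightarrow> L1 \<noteq> [] \<and> L3 \<noteq> []"
    "\<forall>x\<in>set X1. \<forall>z\<in>set L1. E x z \<longleftrightarrow> H = [] \<and> x = last X1 \<and> z = last L1"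
    "\<forall>x\<in>set X1. \<forall>z\<in>set L3. E x z \<longleftrightarrow> H = [] \<and> x = last X1 \<and> z = hd L3"
    "\<forall>z\<in>set L1. \<forall>w\<in>set L3. E z w \<longleftrightarrow> H = [] \<and> z = last L1 \<and> w = hd L3"
    "length S1 \<le> length L1" "length S3 \<le> length L3"
proof -
  have sym: "E a b \<longleftrightarrow> E b a" for a b using E by (auto simp: symp_def)
  obtain X' x where Xx: "X = X' @ [x]" using X by (cases X rule: rev_cases) auto
  have X': "X' \<noteq> []" using X Xx by auto
  have onlyx: "\<not> E u z" if "u \<in> set X'" "z \<in> set L" for u z
    using only that X Xx by (auto simp: ipath_append)
  obtain z where z: "z \<in> set L" "E x z" using ex Xx by auto
  from z show thesis
  proof (cases rule: contact_split)
    case (single L1 h L3)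
    have "h \<notin> set S1" "h \<notin> set S3" using S single Xx by auto
    moreover have "L1 @ h # L3 = S1 @ S2 @ S3" using S(1) single(1) by simp
    \<comment> \<open>Reversal turns the bound for prefixes into the one for the suffix
      \<open>S3\<close>.\<close>
    moreover from arg_cong[OF this, of rev] have "rev L3 @ h # rev L1 = rev S3 @ rev (S1 @ S2)"
      by (simp only: rev_append rev.simps append.assoc append.simps)
    ultimately have "length S1 \<le> length L1" "length (rev S3) \<le> length (rev L3)"
      using length_le_if_hit[of L1 h L3 S1] length_le_if_hit[of "rev L3" h "rev L1" "rev S3"] by auto
    then show thesis
      using L X single disj onlyx
      by (intro that[of L1 "[h]" L3 "[h]" X]) (auto simp: Xx ipath_append sym)
  next
    case (several L1 a M b L3)
    have "a \<notin> set S1" "b \<notin> set S3" using S several Xx by auto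
    moreover have "L1 @ a # (M @ b # L3) = S1 @ S2 @ S3" using S(1) several(1) by simp
    moreover from arg_cong[OF this, of rev] have "rev L3 @ b # rev (L1 @ a # M) = rev S3 @ rev (S1 @ S2)"
      by (simp only: rev_append rev.simps append.assoc append.simps)
    ultimately have len: "length S1 \<le> length L1" "length (rev S3) \<le> length (rev L3)"
      using length_le_if_hit[of L1 a "M @ b # L3" S1] length_le_if_hit[of "rev L3" b "rev (L1 @ a # M)" "rev S3"]
      by auto
    show thesis
    proof (cases "M = []")
      case True
      then show thesis
        using L X several disj onlyx len
        by (intro that[of "L1 @ [a]" "[]" "b # L3" "[]" X]) (auto simp: Xx ipath_append sym)
    next
      case False
      \<comment> \<open>The only neighbour of \<open>a\<close> behind it on \<open>L\<close> is
        \<open>hd M\<close>, so \<open>a\<close> is not adjacent to the part from \<open>b\<close>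
        on.\<close>
      have M: "hd M \<notin> set L3"
        using L several(1) hd_in_set[OF False] by (auto simp: ipath_append)
      then show thesis
        using L X several disj onlyx len False X' M
        by (intro that[of "L1 @ [a]" M "b # L3" "[x]" X']) (auto simp: Xx ipath_append sym)
    qed
  qed
qed

text \<open>The induced subgraph found in a graph of large isometric path complexity: three disjoint
  induced paths \<open>A\<close>, \<open>B\<close>, \<open>C\<close> joined at either end by a hub. A hub \<open>[h]\<close> is a vertex attached to the
  three path ends; the empty hub \<open>[]\<close> stands for a triangle on the path ends. The two kinds of hub
  at the two ends give thetas, pyramids and prisms.\<close>

definition cross :: "('a \<Rightarrow> 'a \<Rightarrow> bool) \<Rightarrow> bool \<Rightarrow> bool \<Rightarrow> 'a list \<Rightarrow> 'a list \<Rightarrow> bool" where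
  "cross E s t X Y \<longleftrightarrow> set X \<inter> set Y = {} \<and>
     (\<forall>x\<in>set X. \<forall>y\<in>set Y. E x y \<longleftrightarrow> s \<and> x = hd X \<and> y = hd Y \<or> t \<and> x = last X \<and> y = last Y)"

definition web :: "('a \<Rightarrow> 'a \<Rightarrow> bool) \<Rightarrow> 'a list \<Rightarrow> 'a list \<Rightarrow> 'a list \<Rightarrow> 'a list \<Rightarrow> 'a list \<Rightarrow> bool" where
  "web E H A B C H' \<longleftrightarrow> length H \<le> 1 \<and> length H' \<le> 1 \<and>
     (\<forall>X\<in>{A, B, C}. 4 \<le> length X \<and> ipath E (H @ X @ H')) \<and>
     cross E (H = []) (H' = []) A B \<and> cross E (H = []) (H' = []) A C \<and> cross E (H = []) (H' = []) B C"

lemma disjoint_ends: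
  assumes "xs \<noteq> []" "set xs \<subseteq> A" "A \<inter> B = {}"
  shows "hd xs \<notin> B" "last xs \<notin> B"
  using assms by (meson disjoint_iff hd_in_set last_in_set subsetD)+

text \<open>Here \<open>P\<close> and \<open>W\<close> form an induced cycle, and \<open>X\<close> is a path across it. The hubs arise from the two
  ends of \<open>X\<close>: a unique neighbour on the cycle is a vertex hub, two adjacent neighbours give a triangle,
  and otherwise the end of \<open>X\<close> itself is the hub.\<close>

lemma turtle_imp_web:
  assumes E: "symp E" "irreflp E"
    and P: "ipath E P" and W: "ipath E W" and X: "ipath E X" "6 \<le> length X"
    and disj: "set P \<inter> set W = {}" "set P \<inter> set X = {}" "set W \<inter> set X = {}"
    and PW: "\<forall>p\<in>set P. \<forall>w\<in>set W. E p w \<longleftrightarrow> p = hd P \<and> w = hd W \<or> p = last P \<and> w = last W"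
    and XP: "\<forall>x\<in>set X. \<forall>p\<in>set P. E x p \<longrightarrow> x = hd X" "\<exists>p\<in>set P. E (hd X) p"
    and XW: "\<forall>x\<in>set X. \<forall>w\<in>set W. E x w \<longrightarrow> x = last X" "\<exists>w\<in>set W. E (last X) w"
    and S: "P = S1 @ S2 @ S3" "\<forall>z\<in>set S1 \<union> set S3. \<not> E (hd X) z" "4 \<le> length S1" "4 \<le> length S3"
  shows "\<exists>H A B C H'. web E H A B C H' \<and> set (H @ A @ B @ C @ H') \<subseteq> set P \<union> set W \<union> set X"
proof -
  have sym: "E a b \<longleftrightarrow> E b a" for a b using E by (auto simp: symp_def)
  have X0: "X \<noteq> []" using X by auto
  \<comment> \<open>\<open>split_hub\<close> works at the last vertex of its path, whereas
    \<open>X\<close> meets \<open>P\<close> at its first; hence \<open>rev X\<close>.\<close>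
  obtain H L1 M L3 Y where 1: "P = L1 @ M @ L3" "length H \<le> 1"
    "ipath E (Y @ H)" "ipath E (L1 @ H)" "ipath E (H @ L3)"
    "Y = rev X \<and> H = M \<or> Y = butlast (rev X) \<and> H = [last (rev X)] \<and> M \<noteq> [] \<and> L1 \<noteq> [] \<and> L3 \<noteq> []"
    "M = [] \<longrightarrow> L1 \<noteq> [] \<and> L3 \<noteq> []"
    "\<forall>x\<in>set Y. \<forall>z\<in>set L1. E x z \<longleftrightarrow> H = [] \<and> x = last Y \<and> z = last L1"
    "\<forall>x\<in>set Y. \<forall>z\<in>set L3. E x z \<longleftrightarrow> H = [] \<and> x = last Y \<and> z = hd L3"
    "\<forall>z\<in>set L1. \<forall>w\<in>set L3. E z w \<longleftrightarrow> H = [] \<and> z = last L1 \<and> w = hd L3"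
    "length S1 \<le> length L1" "length S3 \<le> length L3"
    by (rule split_hub[of E P "rev X" S1 S2 S3]) (use assms X0 in \<open>auto simp: ipath_rev last_rev\<close>)
  define X1 where "X1 = rev Y"
  have Y: "Y = rev X1" by (simp add: X1_def)
  have lX1: "5 \<le> length X1" and iX1: "ipath E X1" and H_eq: "X1 = X \<and> H = M \<or> X1 = tl X \<and> H = [hd X] \<and> M \<noteq> []"
    using 1(3,6) X by (auto simp: X1_def ipath_rev ipath_append last_rev E butlast_rev)
  have X1: "last X1 = last X" "set X1 \<subseteq> set X" "X1 \<noteq> []"
    using H_eq X lX1 by (cases X; auto)+
  \<comment> \<open>No contact-free ends are prescribed on \<open>W\<close>: \<open>K1\<close> and
    \<open>K3\<close> may be short or empty, as \<open>L1\<close> and \<open>L3\<close> already have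
    length at least 4.\<close>
  obtain H' K1 M' K3 X2 where 2: "W = K1 @ M' @ K3" "length H' \<le> 1"
    "ipath E (X2 @ H')" "ipath E (K1 @ H')" "ipath E (H' @ K3)"
    "X2 = X1 \<and> H' = M' \<or> X2 = butlast X1 \<and> H' = [last X1] \<and> M' \<noteq> [] \<and> K1 \<noteq> [] \<and> K3 \<noteq> []"
    "M' = [] \<longrightarrow> K1 \<noteq> [] \<and> K3 \<noteq> []"
    "\<forall>x\<in>set X2. \<forall>z\<in>set K1. E x z \<longleftrightarrow> H' = [] \<and> x = last X2 \<and> z = last K1"
    "\<forall>x\<in>set X2. \<forall>z\<in>set K3. E x z \<longleftrightarrow> H' = [] \<and> x = last X2 \<and> z = hd K3"
    "\<forall>z\<in>set K1. \<forall>w\<in>set K3. E z w \<longleftrightarrow> H' = [] \<and> z = last K1 \<and> w = hd K3"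
    by (rule split_hub[of E W X1 "[]" W "[]"]) (use assms X1 iX1 lX1 in auto)
  \<comment> \<open>Each end of \<open>X\<close> loses at most one vertex to a hub, so 6 vertices
    leave at least 4.\<close>
  have X2: "4 \<le> length X2" "X2 \<noteq> []" "hd X2 = hd X1" "set X2 \<subseteq> set X1"
  proof -
    obtain a b c d e Z where "X1 = a # b # c # d # e # Z"
      using lX1 by (cases X1; cases "tl X1"; cases "tl (tl X1)"; cases "tl (tl (tl X1))"; cases "tl (tl (tl (tl X1)))") auto
    then show "4 \<le> length X2" "X2 \<noteq> []" "hd X2 = hd X1" "set X2 \<subseteq> set X1"
      using 2(6) by (auto dest: in_set_butlastD split: if_splits)
  qed
  have L: "L1 \<noteq> []" "L3 \<noteq> []" "4 \<le> length L1" "4 \<le> length L3" using 1(11,12) S by auto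
  have hd_X: "hd X \<noteq> last X" "hd X \<in> set X" "last X \<in> set X"
    using X by (cases X; auto)+
  have dP: "set L1 \<inter> set L3 = {}" "set M \<inter> set L1 = {}" "set M \<inter> set L3 = {}"
    using P by (auto simp: 1(1) ipath_append)
  have dW: "set K1 \<inter> set K3 = {}" "set M' \<inter> set K1 = {}" "set M' \<inter> set K3 = {}"
    using W by (auto simp: 2(1) ipath_append)
  have ends: "hd P \<in> set L1" "last P \<in> set L3" "hd P = hd L1" "last P = last L3"
    using L by (auto simp: 1(1))
  have LW: "E z w \<longleftrightarrow> z = hd L1 \<and> w = hd W" if "z \<in> set L1" "w \<in> set W" for z w
    using PW that ends dP by (auto simp: 1(1))
  have L3W: "E z w \<longleftrightarrow> z = last L3 \<and> w = last W" if "z \<in> set L3" "w \<in> set W" for z w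
    using PW that ends dP by (auto simp: 1(1))
  have MW: "\<not> E z w" if "z \<in> set M" "w \<in> set W" for z w
    using PW that ends dP by (auto simp: 1(1))
  have HW: "\<not> E z w" if "z \<in> set H" "w \<in> set W" for z w
    using H_eq that MW XW(1) hd_X by auto
  have lastX: "\<not> E (last X) z" "\<not> E z (last X)" if "z \<in> set P" for z
    using XP(1) hd_X that sym[of z "last X"] by auto
  have H'sub: "set H' \<subseteq> set M' \<union> {last X}" "set H \<subseteq> set M \<union> {hd X}"
    using 2(6) X1 H_eq by auto
  have revH: "rev H = H" "rev H' = H'"
    using 1(2) 2(2) by (cases H; cases H'; auto)+
  \<comment> \<open>If the first contact on \<open>W\<close> is the only one and is its first
    vertex, \<open>K1\<close> is empty and the hub itself is the end of \<open>W\<close> adjacent to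
    \<open>P\<close>; hence that end is read off \<open>K1 @ H'\<close>. A hub \<open>last X\<close>
    lies off \<open>W\<close>, which is why it is set aside.\<close>
  have hdW: "hd W = hd (K1 @ H')" "w \<in> set W" if "w \<in> set (K1 @ H')" "K1 = [] \<or> w \<noteq> last X" for w
  proof -
    have "K1 \<noteq> [] \<or> H' = M' \<and> M' \<noteq> []" using 2(6,7) by blast
    then show "hd W = hd (K1 @ H')" by (cases "K1 = []") (auto simp: 2(1))
    have "set H' \<subseteq> set M' \<union> {last X}" "K1 = [] \<Longrightarrow> H' = M'" using H'sub 2(6) by auto
    then show "w \<in> set W" using that by (auto simp: 2(1))
  qed
  have lastW: "last W = last (H' @ K3)" "w \<in> set W" if "w \<in> set (H' @ K3)" "K3 = [] \<or> w \<noteq> last X" for w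
  proof -
    have "K3 \<noteq> [] \<or> H' = M' \<and> M' \<noteq> []" using 2(6,7) by blast
    then show "last W = last (H' @ K3)" by (cases "K3 = []") (auto simp: 2(1))
    have "set H' \<subseteq> set M' \<union> {last X}" "K3 = [] \<Longrightarrow> H' = M'" using H'sub 2(6) by auto
    then show "w \<in> set W" using that by (auto simp: 2(1))
  qed
  have KW: "set K1 \<subseteq> set W" "set K3 \<subseteq> set W" by (auto simp: 2(1))
  have WP: "set W \<inter> set P = {}" using disj by auto
  have hdW': "hd (K1 @ H') \<noteq> last X" if "K1 \<noteq> []"
    using disjoint_ends(1)[OF that KW(1) disj(3)] that hd_X(3) by auto
  have lastW': "last (H' @ K3) \<noteq> last X" if "K3 \<noteq> []"
    using disjoint_ends(2)[OF that KW(2) disj(3)] that hd_X(3) by auto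
  have LP: "set L1 \<subseteq> set P" "set L3 \<subseteq> set P" by (auto simp: 1(1))
  have K1H': "E z w \<longleftrightarrow> z = hd L1 \<and> w = hd (K1 @ H')" if "z \<in> set L1" "w \<in> set (K1 @ H')" for z w
  proof (cases "K1 = [] \<or> w \<noteq> last X")
    case True
    then show ?thesis using hdW[OF that(2)] LW[OF that(1)] by auto
  next
    case False
    then show ?thesis using lastX that LP hdW' by auto
  qed
  have L3H': "E z w \<longleftrightarrow> z = last L3 \<and> w = last (H' @ K3)" if "z \<in> set L3" "w \<in> set (H' @ K3)" for z w
  proof (cases "K3 = [] \<or> w \<noteq> last X")
    case True
    then show ?thesis using lastW[OF that(2)] L3W[OF that(1)] by auto
  next
    case False
    then show ?thesis using lastX that LP lastW' by auto
  qed
  \<comment> \<open>Both hubs may be vertices. They are kept apart because \<open>M\<close> has no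
    contact with \<open>W\<close>, neither end of \<open>X\<close> has contacts on the opposite
    side, and the ends of the long path \<open>X\<close> are not adjacent.\<close>
  have HH': "\<not> E z w \<and> z \<noteq> w" if "z \<in> set H" "w \<in> set H'" for z w
  proof -
    obtain a b c d Z where "X = a # b # c # d # Z"
      using X(2) by (cases X; cases "tl X"; cases "tl (tl X)"; cases "tl (tl (tl X))") auto
    then have "\<not> E (hd X) (last X)" using X by auto
    moreover have zw: "z \<in> set M \<or> z = hd X" "w \<in> set M' \<or> w = last X" using that H'sub by auto
    moreover have MP: "set M \<subseteq> set P" "set M' \<subseteq> set W" by (auto simp: 1(1) 2(1))
    ultimately have "\<not> E z w"
      using MW[of z w] lastX(2)[of z] XW(1) hd_X(1,2) by blast
    moreover have "z \<noteq> w" using zw MP disj hd_X by blast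
    ultimately show ?thesis by simp
  qed
  have HK: "\<not> E z w \<and> z \<noteq> w" if "z \<in> set H" "w \<in> set K1 \<union> set K3" for z w
  proof -
    have "w \<in> set W" using that by (auto simp: 2(1))
    moreover have "z \<in> set P \<union> set X" using that H'sub hd_X by (auto simp: 1(1))
    ultimately show ?thesis using HW[OF that(1)] disj by auto
  qed
  have H'L: "z \<noteq> w" if "z \<in> set H'" "w \<in> set L1 \<union> set L3" for z w
    using that H'sub disj hd_X by (auto simp: 1(1) 2(1))
  have iL1: "ipath E (H @ rev L1)"
    using 1(4) ipath_rev[OF E(1), of "L1 @ H"] revH by simp
  have iK3: "ipath E (rev K3 @ H')"
    using 2(5) ipath_rev[OF E(1), of "H' @ K3"] revH by simp
  have iX1: "ipath E (H @ X1)"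
    using 1(3) ipath_rev[OF E(1), of "Y @ H"] revH by (simp add: X1_def)
  have HL: "z \<noteq> w" if "z \<in> set H" "w \<in> set L1 \<union> set L3" for z w
    using that H'sub(2) dP LP disj(2) hd_X(2) by blast
  have HKH': "\<not> E z w \<and> z \<noteq> w" if "z \<in> set H" "w \<in> set K1 \<union> set H' \<union> set K3" for z w
    using that HK HH' by blast
  have LKH': "z \<noteq> w" if "z \<in> set L1 \<union> set L3" "w \<in> set K1 \<union> set H' \<union> set K3" for z w
    using that H'L LP KW disj(1) by blast
  have K0: "K1 \<noteq> []" "K3 \<noteq> []" if "H' = []" using that 2(6,7) by auto
  have lastA: "last (rev L1 @ K1) = last K1" if "H' = []" using K0[OF that] by simp
  have lastC: "last (L3 @ rev K3) = hd K3" if "H' = []" using K0[OF that] by (simp add: last_rev)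
  have ends': "last (rev L1 @ K1) \<notin> set L1" "last (L3 @ rev K3) \<notin> set L3" if "H' = []"
    using disjoint_ends(2)[OF K0(1) KW(1) WP] disjoint_ends(1)[OF K0(2) KW(2) WP] LP
    unfolding lastA[OF that] lastC[OF that] using that by blast+
  have lastL1: "last L1 \<notin> set K1" using disjoint_ends(2)[OF L(1) LP(1) disj(1)] KW by blast
  have hdL3: "hd L3 \<notin> set K3" using disjoint_ends(1)[OF L(2) LP(2) disj(1)] KW by blast
  have dXs: "set X2 \<inter> (set L1 \<union> set L3 \<union> set K1 \<union> set K3) = {}"
    using X1 X2 disj LP KW by blast
  have lastY: "last Y = hd X2" using X2 by (simp add: Y last_rev X1)
  have X2Y: "set X2 \<subseteq> set Y" using X2 by (simp add: Y)
  have L1X: "E z x \<longleftrightarrow> H = [] \<and> z = last L1 \<and> x = hd X2" if "z \<in> set L1" "x \<in> set X2" for z x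
    using that 1(8) X2Y unfolding lastY by (subst sym) blast
  have L3X: "E x z \<longleftrightarrow> H = [] \<and> z = hd L3 \<and> x = hd X2" if "z \<in> set L3" "x \<in> set X2" for z x
    using that 1(9) X2Y unfolding lastY by blast
  have K1X: "E z x \<longleftrightarrow> H' = [] \<and> z = last K1 \<and> x = last X2" if "z \<in> set K1" "x \<in> set X2" for z x
    using that 2(8) by (subst sym) blast
  have K3X: "E x z \<longleftrightarrow> H' = [] \<and> z = hd K3 \<and> x = last X2" if "z \<in> set K3" "x \<in> set X2" for z x
    using that 2(9) by blast
  have L1L3: "E z w \<longleftrightarrow> H = [] \<and> z = last L1 \<and> w = hd L3" if "z \<in> set L1" "w \<in> set L3" for z w
    using that 1(10) by blast
  have K1K3: "E z w \<longleftrightarrow> H' = [] \<and> z = last K1 \<and> w = hd K3" if "z \<in> set K1" "w \<in> set K3" for z w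
    using that 2(10) by blast
  \<comment> \<open>The three paths of the web are \<open>rev L1 @ K1\<close> and
    \<open>L3 @ rev K3\<close>, the two ways round the cycle from hub to hub, and
    \<open>X2\<close>.\<close>
  have "ipath E ((H @ rev L1) @ (K1 @ H'))"
  proof (subst ipath_append, intro conjI ballI)
    show "set (H @ rev L1) \<inter> set (K1 @ H') = {}" using HKH' LKH' by fastforce
    have last: "last (H @ rev L1) = hd L1" using L by (simp add: last_rev)
    fix z w assume z: "z \<in> set (H @ rev L1)" and w: "w \<in> set (K1 @ H')"
    show "E z w \<longleftrightarrow> z = last (H @ rev L1) \<and> w = hd (K1 @ H')"
    proof (cases "z \<in> set H")
      case True
      then show ?thesis using HKH'[of z w] HL[of z "hd L1"] w L last by auto
    next
      case False
      then have "z \<in> set L1" using z by auto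
      then show ?thesis unfolding last using w by (rule K1H')
    qed
  qed (use iL1 2(4) in auto)
  then have "ipath E (H @ (rev L1 @ K1) @ H')" by simp
  moreover have "ipath E ((H @ L3) @ (rev K3 @ H'))"
  proof (subst ipath_append, intro conjI ballI)
    show "set (H @ L3) \<inter> set (rev K3 @ H') = {}" using HKH' LKH' by fastforce
    have last: "last (H @ L3) = last L3" using L by simp
    have hd: "hd (rev K3 @ H') = last (H' @ K3)"
      using revH(2) by (metis hd_rev rev_append)
    fix z w assume z: "z \<in> set (H @ L3)" and w: "w \<in> set (rev K3 @ H')"
    show "E z w \<longleftrightarrow> z = last (H @ L3) \<and> w = hd (rev K3 @ H')"
    proof (cases "z \<in> set H")
      case True
      then show ?thesis using HKH'[of z w] HL[of z "last L3"] w L last by auto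
    next
      case False
      then have "z \<in> set L3" "w \<in> set (H' @ K3)" using z w by auto
      then show ?thesis unfolding last hd by (rule L3H')
    qed
  qed (use 1(5) iK3 in auto)
  then have "ipath E (H @ (L3 @ rev K3) @ H')" by simp
  moreover have "ipath E (H @ X2 @ H')"
  proof (subst ipath_append, intro conjI ballI)
    have i: "ipath E H" "set H \<inter> set X1 = {}" "\<forall>z\<in>set H. \<forall>w\<in>set X1. E z w \<longleftrightarrow> z = last H \<and> w = hd X1"
      using iX1 by (simp_all add: ipath_append)
    show "ipath E H" "ipath E (X2 @ H')" by fact+
    show "set H \<inter> set (X2 @ H') = {}" using i(2) HH' X2(4) by fastforce
    fix z w assume z: "z \<in> set H" and w: "w \<in> set (X2 @ H')"
    show "E z w \<longleftrightarrow> z = last H \<and> w = hd (X2 @ H')"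
    proof (cases "w \<in> set X2")
      case True
      then show ?thesis using i(3) z X2 by auto
    next
      case False
      then have "\<not> E z w" "w \<noteq> hd X2" using HH'[OF z, of w] w X2(2) by auto
      then show ?thesis using X2(2) by simp
    qed
  qed
  moreover have "cross E (H = []) (H' = []) (rev L1 @ K1) X2"
    unfolding cross_def
  proof (intro conjI ballI)
    show "set (rev L1 @ K1) \<inter> set X2 = {}"
      using dXs by auto
    have hd: "hd (rev L1 @ K1) = last L1" using L by (simp add: hd_append hd_rev)
    fix z x assume z: "z \<in> set (rev L1 @ K1)" and x: "x \<in> set X2"
    show "E z x \<longleftrightarrow> H = [] \<and> z = hd (rev L1 @ K1) \<and> x = hd X2 \<or>
      H' = [] \<and> z = last (rev L1 @ K1) \<and> x = last X2"
    proof (cases "z \<in> set L1")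
      case True
      then have "H' = [] \<Longrightarrow> z \<noteq> last (rev L1 @ K1)" using ends'(1) by metis
      then show ?thesis unfolding hd L1X[OF True x] by (cases "H' = []") simp_all
    next
      case False
      then have K: "z \<in> set K1" using z by auto
      then have "z \<noteq> last L1" using lastL1 by metis
      then show ?thesis unfolding hd K1X[OF K x] using lastA by (cases "H' = []") simp_all
    qed
  qed
  moreover have "cross E (H = []) (H' = []) (rev L1 @ K1) (L3 @ rev K3)"
    unfolding cross_def
  proof (intro conjI ballI)
    show "set (rev L1 @ K1) \<inter> set (L3 @ rev K3) = {}"
      using dP dW LP KW disj(1) by auto
    have hd: "hd (rev L1 @ K1) = last L1" "hd (L3 @ rev K3) = hd L3" using L by (simp_all add: hd_append hd_rev)
    fix z w assume z: "z \<in> set (rev L1 @ K1)" and w: "w \<in> set (L3 @ rev K3)"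
    \<comment> \<open>The only edge between \<open>L1\<close> and \<open>W\<close> ends at
      \<open>hd W\<close>, which lies in \<open>K1\<close> or, if that is empty, in
      \<open>M'\<close>; so \<open>L1\<close> and \<open>K3\<close> are not adjacent. The same holds
      for \<open>last W\<close> on the other side.\<close>
    have "hd W \<notin> set K3"
    proof (cases "K1 = []")
      case True
      then have "M' \<noteq> []" "hd W = hd M'" using 2(7) by (auto simp: 2(1))
      then show ?thesis using disjoint_ends(1)[OF _ order_refl dW(3)] by simp
    next
      case False
      then have "hd W = hd K1" by (simp add: 2(1))
      then show ?thesis using disjoint_ends(1)[OF False order_refl dW(1)] by simp
    qed
    have "last W \<notin> set K1"
    proof (cases "K3 = []")
      case True
      then have "M' \<noteq> []" "last W = last M'" using 2(7) by (auto simp: 2(1))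
      then show ?thesis using disjoint_ends(2)[OF _ order_refl dW(2)] by simp
    next
      case False
      then have "last W = last K3" by (simp add: 2(1))
      then show ?thesis using disjoint_ends(2)[OF False order_refl, of "set K1"] dW(1) by (simp add: Int_commute)
    qed
    have LK: "\<not> E z w" if "z \<in> set L1 \<and> w \<in> set K3 \<or> z \<in> set K1 \<and> w \<in> set L3"
      using that
    proof
      assume *: "z \<in> set L1 \<and> w \<in> set K3"
      then have "w \<noteq> hd W" using \<open>hd W \<notin> set K3\<close> by metis
      then show ?thesis using LW[of z w] * KW by auto
    next
      assume *: "z \<in> set K1 \<and> w \<in> set L3"
      then have "z \<noteq> last W" using \<open>last W \<notin> set K1\<close> by metis
      then show ?thesis using L3W[of w z] * KW sym[of z w] by auto
    qed
    consider "z \<in> set L1" "w \<in> set L3" | "z \<in> set L1" "w \<in> set K3" | "z \<in> set K1" "w \<in> set L3" | "z \<in> set K1" "w \<in> set K3"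
      using z w by auto
    then show "E z w \<longleftrightarrow> H = [] \<and> z = hd (rev L1 @ K1) \<and> w = hd (L3 @ rev K3) \<or>
      H' = [] \<and> z = last (rev L1 @ K1) \<and> w = last (L3 @ rev K3)"
    proof cases
      case 1
      then have "H' = [] \<Longrightarrow> z \<noteq> last (rev L1 @ K1)" using ends'(1) by metis
      then show ?thesis unfolding hd L1L3[OF 1] by (cases "H' = []") simp_all
    next
      case 2
      then have "H' = [] \<Longrightarrow> z \<noteq> last (rev L1 @ K1)" "w \<noteq> hd L3" using ends'(1) hdL3 by metis+
      then show ?thesis unfolding hd using LK 2 by (cases "H' = []") simp_all
    next
      case 3
      then have "H' = [] \<Longrightarrow> w \<noteq> last (L3 @ rev K3)" "z \<noteq> last L1" using ends'(2) lastL1 by metis+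
      then show ?thesis unfolding hd using LK 3 by (cases "H' = []") simp_all
    next
      case 4
      then have "z \<noteq> last L1" using lastL1 by metis
      then show ?thesis unfolding hd K1K3[OF 4] using lastA lastC by (cases "H' = []") simp_all
    qed
  qed
  moreover have "cross E (H = []) (H' = []) X2 (L3 @ rev K3)"
    unfolding cross_def
  proof (intro conjI ballI)
    show "set X2 \<inter> set (L3 @ rev K3) = {}" using dXs by auto
    have hd: "hd (L3 @ rev K3) = hd L3" using L by simp
    fix x z assume x: "x \<in> set X2" and z: "z \<in> set (L3 @ rev K3)"
    show "E x z \<longleftrightarrow> H = [] \<and> x = hd X2 \<and> z = hd (L3 @ rev K3) \<or>
      H' = [] \<and> x = last X2 \<and> z = last (L3 @ rev K3)"
    proof (cases "z \<in> set L3")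
      case True
      then have "H' = [] \<Longrightarrow> z \<noteq> last (L3 @ rev K3)" using ends'(2) by metis
      then show ?thesis unfolding hd L3X[OF True x] by (cases "H' = []") auto
    next
      case False
      then have K: "z \<in> set K3" using z by auto
      then have "z \<noteq> hd L3" using hdL3 by metis
      then show ?thesis unfolding hd K3X[OF K x] using lastC by (cases "H' = []") auto
    qed
  qed
  ultimately have "web E H (rev L1 @ K1) X2 (L3 @ rev K3) H'"
    using 1(2) 2(2) L X2(1) by (simp add: web_def)
  moreover have "set (H @ (rev L1 @ K1) @ X2 @ (L3 @ rev K3) @ H') \<subseteq> set P \<union> set W \<union> set X"
    using H'sub hd_X X1 X2 1(1) 2(1) by auto
  ultimately show ?thesis by blast
qed

section \<open>Induced thetas, pyramids and prisms\<close>

abbreviation adj :: "('a, 'b) pre_digraph \<Rightarrow> 'a \<Rightarrow> 'a \<Rightarrow> bool" where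
  "adj G u w \<equiv> u \<rightarrow>\<^bsub>G\<^esub> w"

lemma adj_symp:
  assumes "Digraph.graph G" shows "symp (adj G)"
proof -
  interpret Digraph.graph G by fact
  show ?thesis using sym_arcs by (auto simp: symmetric_def intro: sympI dest: symD)
qed

lemma adj_irreflp:
  assumes "Digraph.graph G" shows "irreflp (adj G)"
proof -
  interpret Digraph.graph G by fact
  show ?thesis by (auto simp: irreflp_def arcs_ends_conv dest: no_loops)
qed

lemma vwalk_iff_successively:
  "vwalk p G \<longleftrightarrow> p \<noteq> [] \<and> set p \<subseteq> verts G \<and> successively (adj G) p"
proof -
  have "set (vwalk_arcs p) \<subseteq> arcs_ends G \<longleftrightarrow> successively (adj G) p"
    by (induction p rule: vwalk_arcs.induct) auto
  then show ?thesis by (auto simp: vwalk_def)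
qed

text \<open>A chordless path contains every edge between its vertices. This lets whole edge sets, as
  in the definition of a theta, be compared through adjacency.\<close>

lemma path_edges_ipath:
  assumes "symp E" "irreflp E" "ipath E p"
  shows "path_edges p = {(u, w). u \<in> set p \<and> w \<in> set p \<and> E u w}"
  using assms(3)
proof (induction p)
  case (Cons x p)
  show ?case
  proof (cases "p = []")
    case True
    then show ?thesis using assms(2) by (auto simp: path_edges_def irreflp_def)
  next
    case False
    then have "path_edges (x # p) = {(x, hd p), (hd p, x)} \<union> path_edges p"
      by (auto simp: path_edges_def)
    moreover have "path_edges p = {(u, w). u \<in> set p \<and> w \<in> set p \<and> E u w}" using Cons by simp
    moreover have "E x w \<longleftrightarrow> w = hd p" "E w x \<longleftrightarrow> w = hd p" if "w \<in> set p" for w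
      using that Cons.prems assms(1) by (auto dest: sympD)
    moreover have "hd p \<in> set p" "x \<notin> set p" "\<not> E x x"
      using False Cons.prems assms(2) by (auto simp: irreflp_def)
    ultimately show ?thesis by fastforce
  qed
qed (simp add: path_edges_def)


lemma arcs_ends_induce_subgraph:
  "arcs_ends (G \<restriction> S) = {(u, w). u \<in> S \<and> w \<in> S \<and> adj G u w}"
  by (auto simp: arcs_ends_conv)

lemma induced_path_if_ipath:
  assumes "Digraph.graph G" "ipath (adj G) p" "p \<noteq> []" "set p \<subseteq> S"
  shows "induced_path (G \<restriction> S) p"
proof -
  have "adj (G \<restriction> S) u w \<longleftrightarrow> adj G u w" if "u \<in> set p" "w \<in> set p" for u w
    using that assms by (auto simp: arcs_ends_induce_subgraph)
  then have s: "successively (adj (G \<restriction> S)) p"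
    using ipath_successively[OF assms(2)] by (simp cong: successively_cong)
  have p: "distinct p" "\<forall>i<length p. \<forall>j<length p. adj G (p ! i) (p ! j) \<longleftrightarrow> j = Suc i \<or> i = Suc j"
    using iffD1[OF ipath_nth[OF adj_symp[OF assms(1)] adj_irreflp[OF assms(1)]] assms(2)] by simp_all
  have "vpath p (G \<restriction> S)"
    unfolding vpath_def vwalk_iff_successively using s p(1) assms by simp
  moreover have "\<not> adj (G \<restriction> S) (p ! i) (p ! j)"
    if "i < length p" "j < length p" "i \<noteq> j" "j \<noteq> Suc i" "i \<noteq> Suc j" for i j
  proof -
    have "\<not> adj G (p ! i) (p ! j)" using p(2)[rule_format, OF that(1,2)] that(4,5) by simp
    then show ?thesis by (rule contrapos_nn) (rule dominates_induce_subgraphD)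
  qed
  ultimately show ?thesis unfolding induced_path_def by blast
qed

text \<open>The subgraph induced on the web is a theta if both hubs are vertices, a pyramid if
  exactly one is, and a prism if none is.\<close>

lemma web_imp_theta_pyramid_prism:
  assumes G: "Digraph.graph G" and web: "web (adj G) H A B C H'"
    and V: "set (H @ A @ B @ C @ H') \<subseteq> verts G"
  shows "\<not> theta_pyramid_prism_free G"
proof -
  define S where "S = set (H @ A @ B @ C @ H')"
  define F where "F X = H @ X @ H'" for X
  let ?K = "G \<restriction> S"
  interpret Digraph.graph G by fact
  have K: "induced_subgraph ?K G" using V by (auto simp: S_def)
  then have gK: "Digraph.graph ?K"
    using induced_graph_imp_graph[OF K] digraphI_induced[OF K]
    by (simp add: Digraph.graph_def pseudo_graph_def digraph_def)
  have lens: "4 \<le> length A" "4 \<le> length B" "4 \<le> length C" "length H \<le> 1" "length H' \<le> 1"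
    and ip: "ipath (adj G) (F A)" "ipath (adj G) (F B)" "ipath (adj G) (F C)"
    and cr: "cross (adj G) (H = []) (H' = []) A B" "cross (adj G) (H = []) (H' = []) A C" "cross (adj G) (H = []) (H' = []) B C"
    using web by (auto simp: web_def F_def)
  have ne: "A \<noteq> []" "B \<noteq> []" "C \<noteq> []" using lens by auto
  have sym: "adj G u w \<longleftrightarrow> adj G w u" for u w
    using adj_symp[OF G] by (auto simp: symp_def)
  have pe: "path_edges (F X) = {(u, w). u \<in> set (F X) \<and> w \<in> set (F X) \<and> adj G u w}" if "X \<in> {A, B, C}" for X
    using path_edges_ipath[OF adj_symp[OF G] adj_irreflp[OF G]] ip that by auto
  have pK: "induced_path ?K (F X)" if "X \<in> {A, B, C}" for X
    using that ip ne by (intro induced_path_if_ipath G) (auto simp: F_def S_def)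
  have pKr: "induced_path ?K (rev (F X))" if "X \<in> {A, B, C}" for X
    using that ip ne
    by (intro induced_path_if_ipath G) (auto simp: F_def S_def ipath_rev[OF adj_symp[OF G]] simp del: rev_append)
  have vK: "verts ?K = set (F A) \<union> set (F B) \<union> set (F C)"
    by (auto simp: F_def S_def)
  \<comment> \<open>An empty hub contributes a triangle; a vertex hub contributes only edges that
    already lie on the paths \<open>F X\<close>.\<close>
  let ?T = "if H = [] then triangle_edges (hd A) (hd B) (hd C) else {}"
  let ?T' = "if H' = [] then triangle_edges (last A) (last B) (last C) else {}"
  have cr': "set X \<inter> set Y = {} \<and> (u \<in> set X \<longrightarrow> w \<in> set Y \<longrightarrow> adj G u w \<longleftrightarrow>
      H = [] \<and> u = hd X \<and> w = hd Y \<or> H' = [] \<and> u = last X \<and> w = last Y)"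
    if "(X, Y) \<in> {(A, B), (A, C), (B, C), (B, A), (C, A), (C, B)}" for X Y u w
  proof (cases "(X, Y) \<in> {(A, B), (A, C), (B, C)}")
    case True
    then have "cross (adj G) (H = []) (H' = []) X Y" using cr by auto
    then show ?thesis by (simp add: cross_def)
  next
    case False
    then have "cross (adj G) (H = []) (H' = []) Y X" using that cr by auto
    then have "set Y \<inter> set X = {}"
      "w \<in> set Y \<longrightarrow> u \<in> set X \<longrightarrow> adj G w u \<longleftrightarrow>
        H = [] \<and> w = hd Y \<and> u = hd X \<or> H' = [] \<and> w = last Y \<and> u = last X"
      by (simp_all add: cross_def)
    then show ?thesis unfolding sym[of u w] Int_commute[of "set X"] by argo
  qed
  have triE: "(u, w) \<in> ?T \<union> ?T'"
    if "(X, Y) \<in> {(A, B), (A, C), (B, C), (B, A), (C, A), (C, B)}" "u \<in> set X" "w \<in> set Y" "adj G u w" for X Y u w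
  proof -
    have "u \<noteq> w" using cr'[OF that(1), of u w] that(2,3) by auto
    moreover have "H = [] \<and> u = hd X \<and> w = hd Y \<or> H' = [] \<and> u = last X \<and> w = last Y"
      using cr'[OF that(1), of u w] that(2-) by simp
    ultimately show ?thesis using that(1) by (auto simp: triangle_edges_def)
  qed
  have triI: "adj G (hd X) (hd Y)" if "(X, Y) \<in> {(A, B), (A, C), (B, C), (B, A), (C, A), (C, B)}" "H = []" for X Y
    using cr'[OF that(1), of "hd X" "hd Y"] that ne by auto
  have triI': "adj G (last X) (last Y)" if "(X, Y) \<in> {(A, B), (A, C), (B, C), (B, A), (C, A), (C, B)}" "H' = []" for X Y
    using cr'[OF that(1), of "last X" "last Y"] that ne by auto
  \<comment> \<open>An arc inside one \<open>F X\<close> is a path edge; an arc between different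
    paths is allowed by \<open>cross\<close> only at an empty hub.\<close>
  have aK: "arcs_ends ?K = path_edges (F A) \<union> path_edges (F B) \<union> path_edges (F C) \<union> ?T \<union> ?T'"
  proof (intro subset_antisym subrelI)
    fix u w assume "(u, w) \<in> arcs_ends ?K"
    then have uw: "u \<in> S" "w \<in> S" "adj G u w" by (auto simp: arcs_ends_induce_subgraph)
    show "(u, w) \<in> path_edges (F A) \<union> path_edges (F B) \<union> path_edges (F C) \<union> ?T \<union> ?T'"
    proof (cases "\<exists>X\<in>{A, B, C}. u \<in> set (F X) \<and> w \<in> set (F X)")
      case True
      then show ?thesis using pe uw(3) by blast
    next
      case False
      obtain X where X: "X \<in> {A, B, C}" "u \<in> set X" using uw False by (fastforce simp: F_def S_def)
      obtain Y where Y: "Y \<in> {A, B, C}" "w \<in> set Y" using uw False by (fastforce simp: F_def S_def)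
      have "X \<noteq> Y" using False X Y by (auto simp: F_def)
      then have "(X, Y) \<in> {(A, B), (A, C), (B, C), (B, A), (C, A), (C, B)}" using X Y by blast
      then show ?thesis using triE X(2) Y(2) uw(3) by blast
    qed
  next
    fix u w assume uw: "(u, w) \<in> path_edges (F A) \<union> path_edges (F B) \<union> path_edges (F C) \<union> ?T \<union> ?T'"
    consider X where "X \<in> {A, B, C}" "(u, w) \<in> path_edges (F X)" | "(u, w) \<in> ?T" | "(u, w) \<in> ?T'" using uw by blast
    then have "u \<in> S \<and> w \<in> S \<and> adj G u w"
    proof cases
      case 1
      then show ?thesis unfolding pe[OF 1(1)] using 1(1) by (auto simp: F_def S_def)
    next
      case 2
      then have H: "H = []" by (auto split: if_splits)
      then obtain X Y where XY: "(X, Y) \<in> {(A, B), (A, C), (B, C), (B, A), (C, A), (C, B)}" "u = hd X" "w = hd Y"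
        using 2 unfolding triangle_edges_def by auto
      then have "X \<noteq> []" "Y \<noteq> []" "set X \<subseteq> S" "set Y \<subseteq> S" using ne by (auto simp: S_def)
      then have "u \<in> S" "w \<in> S" unfolding XY(2,3) by auto
      then show ?thesis using triI[OF XY(1) H] XY(2,3) by simp
    next
      case 3
      then have H: "H' = []" by (auto split: if_splits)
      then obtain X Y where XY: "(X, Y) \<in> {(A, B), (A, C), (B, C), (B, A), (C, A), (C, B)}" "u = last X" "w = last Y"
        using 3 unfolding triangle_edges_def by auto
      then have "X \<noteq> []" "Y \<noteq> []" "set X \<subseteq> S" "set Y \<subseteq> S" using ne by (auto simp: S_def)
      then have "u \<in> S" "w \<in> S" unfolding XY(2,3) by auto
      then show ?thesis using triI'[OF XY(1) H] XY(2,3) by simp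
    qed
    then show "(u, w) \<in> arcs_ends ?K" by (auto simp: arcs_ends_induce_subgraph)
  qed
  have "set A \<inter> set B = {}" "set A \<inter> set C = {}" "set B \<inter> set C = {}" using cr' by simp_all
  \<comment> \<open>Any two of the full paths share exactly the hub vertices, as the definitions of
    the three graphs demand.\<close>
  then have int: "set (F A) \<inter> set (F B) = set (H @ H')" "set (F A) \<inter> set (F C) = set (H @ H')" "set (F B) \<inter> set (F C) = set (H @ H')"
    using ip by (auto simp: F_def ipath_append)
  have pKs: "induced_path ?K (F A)" "induced_path ?K (F B)" "induced_path ?K (F C)"
    "induced_path ?K (rev (F A))" "induced_path ?K (rev (F B))" "induced_path ?K (rev (F C))"
    by (rule pK pKr; simp)+
  have rev_edges: "path_edges (rev p) = path_edges p" for p :: "'a list"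
    by (auto simp: path_edges_def set_vwalk_arcs_rev)
  have lens': "Suc 0 \<le> length X - Suc 0" "2 \<le> length X" "Suc 0 \<le> length X" if "X \<in> {A, B, C}" for X
    using lens that by auto
  define K where "K = ?K"
  note facts = gK[folded K_def] pKs[folded K_def] vK[folded K_def] aK[folded K_def] int
  have "theta K \<or> pyramid K \<or> prism K"
  proof (cases "H = []")
    case H: True
    show ?thesis
    proof (cases "H' = []")
      case H': True
      have F: "hd (F X) = hd X" "last (F X) = last X" "length (F X) = length X" if "X \<noteq> []" for X
        using that by (simp_all add: F_def H H')
      have "prism K"
        unfolding prism_def
        by (rule conjI[OF facts(1)], rule exI[of _ "hd A"], rule exI[of _ "hd B"], rule exI[of _ "hd C"], rule exI[of _ "last A"], rule exI[of _ "last B"], rule exI[of _ "last C"], rule exI[of _ "F A"], rule exI[of _ "F B"], rule exI[of _ "F C"])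
          (use facts lens' H H' F ne in simp)
      then show ?thesis by simp
    next
      case False
      then obtain b where H': "H' = [b]" using lens by (cases H') auto
      \<comment> \<open>The only vertex hub is at the far end, whereas the paths of a pyramid start
        at its apex; hence all three are reversed.\<close>
      have F: "hd (rev (F X)) = b" "last (rev (F X)) = hd X" "length (F X) = Suc (length X)" if "X \<noteq> []" for X
        using that by (simp_all add: F_def H H' last_rev hd_rev)
      have "pyramid K"
        unfolding pyramid_def
        by (rule conjI[OF facts(1)], rule exI[of _ "b"], rule exI[of _ "hd A"], rule exI[of _ "hd B"], rule exI[of _ "hd C"], rule exI[of _ "rev (F A)"], rule exI[of _ "rev (F B)"], rule exI[of _ "rev (F C)"])
          (use facts lens' H H' F ne rev_edges in simp)
      then show ?thesis by simp
    qed
  next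
    case False
    then obtain a where H: "H = [a]" using lens by (cases H) auto
    show ?thesis
    proof (cases "H' = []")
      case H': True
      have F: "hd (F X) = a" "last (F X) = last X" "length (F X) = Suc (length X)" if "X \<noteq> []" for X
        using that by (simp_all add: F_def H H')
      have "pyramid K"
        unfolding pyramid_def
        by (rule conjI[OF facts(1)], rule exI[of _ "a"], rule exI[of _ "last A"], rule exI[of _ "last B"], rule exI[of _ "last C"], rule exI[of _ "F A"], rule exI[of _ "F B"], rule exI[of _ "F C"])
          (use facts lens' H H' F ne in simp)
      then show ?thesis by simp
    next
      case False
      then obtain b where H': "H' = [b]" using lens by (cases H') auto
      have F: "hd (F X) = a" "last (F X) = b" "length (F X) = Suc (Suc (length X))" if "X \<noteq> []" for X
        using that by (simp_all add: F_def H H')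
      have "theta K"
        unfolding theta_def
        by (rule conjI[OF facts(1)], rule exI[of _ "a"], rule exI[of _ "b"], rule exI[of _ "F A"], rule exI[of _ "F B"], rule exI[of _ "F C"])
          (use facts lens' H H' F ne in simp)
      then show ?thesis by simp
    qed
  qed
  then show ?thesis using K by (auto simp: theta_pyramid_prism_free_def K_def)
qed

section \<open>Outerstring graphs\<close>

text \<open>\<open>fashoda_interlace\<close> speaks of paths in a box of \<open>real^2\<close> with
  all four ends on its lower edge. The map \<open>\<phi>\<close> carries the half-plane there;
  \<open>s = -1\<close> reflects a lower half-plane into an upper one.\<close>

lemma fashoda_half_plane:
  fixes p q :: "real \<Rightarrow> complex" and s c :: real
  assumes s: "s \<in> {1, -1}" and pq: "path p" "path q"
    and half: "\<And>z. z \<in> path_image p \<union> path_image q \<Longrightarrow> s * c \<le> s * Im z"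
    and ground: "Im (pathstart p) = c" "Im (pathfinish p) = c" "Im (pathstart q) = c" "Im (pathfinish q) = c"
    and order: "Re (pathstart p) < Re (pathstart q)" "Re (pathstart q) < Re (pathfinish p)"
      "Re (pathfinish p) < Re (pathfinish q)"
  shows "path_image p \<inter> path_image q \<noteq> {}"
proof -
  define \<phi> :: "complex \<Rightarrow> real^2" where "\<phi> z = (\<chi> i. if i = 1 then Re z else s * Im z)" for z
  have \<phi>: "\<phi> z $ 1 = Re z" "\<phi> z $ 2 = s * Im z" for z by (simp_all add: \<phi>_def)
  have cont: "continuous_on A \<phi>" for A
    unfolding \<phi>_def
  proof (rule continuous_on_vec_lambda)
    show "continuous_on A (\<lambda>z. if i = 1 then Re z else s * Im z)" for i :: 2
      by (cases "i = 1") (auto intro!: continuous_intros)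
  qed
  have inj: "z = w" if "\<phi> z = \<phi> w" for z w
    using s that \<phi>[of z] \<phi>[of w] by (auto simp: complex_eq_iff)
  have "compact (path_image p \<union> path_image q)" using pq by (simp add: compact_Un compact_path_image)
  then obtain B where B: "\<And>z. z \<in> path_image p \<union> path_image q \<Longrightarrow> norm z \<le> B"
    using compact_imp_bounded bounded_iff by metis
  \<comment> \<open>The lower edge of the box lies on the image of the grounding line;
    \<open>B\<close> bounds both paths in the other three directions.\<close>
  define a b :: "real^2" where "a = (\<chi> i. if i = 1 then - B else s * c)" and "b = (\<chi> i. B)"
  have box: "\<phi> z \<in> cbox a b" if "z \<in> path_image p \<union> path_image q" for z
  proof -
    have "\<bar>Re z\<bar> \<le> B" "\<bar>Im z\<bar> \<le> B"
      using B[OF that] abs_Re_le_cmod[of z] abs_Im_le_cmod[of z] by linarith+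
    moreover have "s * Im z \<le> \<bar>Im z\<bar>" using s by auto
    ultimately show ?thesis
      using half[OF that] by (auto simp: mem_box_cart forall_2 \<phi> a_def b_def)
  qed
  obtain z where z: "z \<in> path_image (\<phi> \<circ> p)" "z \<in> path_image (\<phi> \<circ> q)"
  proof (rule fashoda_interlace[of "\<phi> \<circ> p" "\<phi> \<circ> q" a b])
    show "path (\<phi> \<circ> p)" "path (\<phi> \<circ> q)" using pq cont by (auto intro: path_continuous_image)
    show "path_image (\<phi> \<circ> p) \<subseteq> cbox a b" "path_image (\<phi> \<circ> q) \<subseteq> cbox a b"
      using box by (auto simp: path_image_compose)
  qed (use ground order in \<open>auto simp: pathstart_compose pathfinish_compose \<phi> a_def\<close>)
  then obtain z1 z2 where "z1 \<in> path_image p" "z2 \<in> path_image q" "\<phi> z1 = \<phi> z2"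
    by (auto simp: path_image_compose)
  then show ?thesis using inj by blast
qed

lemma path_connected_UN_successively:
  assumes "\<And>s. s \<in> set S \<Longrightarrow> path_connected (f s)" "successively (\<lambda>s t. f s \<inter> f t \<noteq> {}) S"
  shows "path_connected (\<Union>s\<in>set S. f s)"
  using assms
proof (induction S)
  case (Cons x S)
  show ?case
  proof (cases "S = []")
    case False
    then have "f x \<inter> f (hd S) \<noteq> {}" "hd S \<in> set S" using Cons.prems by (auto simp: successively_Cons)
    then have "f x \<inter> (\<Union>s\<in>set S. f s) \<noteq> {}" by blast
    moreover have "path_connected (\<Union>s\<in>set S. f s)" using Cons False by (auto simp: successively_Cons)
    ultimately show ?thesis using Cons.prems(1)[of x] by (simp add: path_connected_Un)
  qed (use Cons in auto)
qed simp

text \<open>Here \<open>g u\<close> is the abscissa of a ground point of the curve of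
  \<open>u\<close>. The curves along a walk have a path-connected union, and two walks without
  common or adjacent vertices have disjoint unions; so their ground points cannot interlace, by
  \<open>fashoda_half_plane\<close>.\<close>

lemma outerstring_noncrossing:
  assumes "outerstring G"
  obtains g :: "'a \<Rightarrow> real" where
    "\<And>u w. u \<in> verts G \<Longrightarrow> w \<in> verts G \<Longrightarrow> u \<noteq> w \<Longrightarrow> \<not> adj G u w \<Longrightarrow> g u \<noteq> g w"
    "\<And>S T u u' w w'. set S \<subseteq> verts G \<Longrightarrow> set T \<subseteq> verts G \<Longrightarrow> successively (adj G) S \<Longrightarrow> successively (adj G) T \<Longrightarrow>
       \<forall>s\<in>set S. \<forall>t\<in>set T. s \<noteq> t \<and> \<not> adj G s t \<Longrightarrow> u \<in> set S \<Longrightarrow> u' \<in> set S \<Longrightarrow> w \<in> set T \<Longrightarrow> w' \<in> set T \<Longrightarrow>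
       \<not> (g u < g w \<and> g w < g u' \<and> g u' < g w')"
proof -
  obtain C f where C: "grounded C" "bij_betw f (verts G) C"
    and adj: "\<And>u v. u \<in> verts G \<Longrightarrow> v \<in> verts G \<Longrightarrow> u \<noteq> v \<Longrightarrow> f u \<inter> f v \<noteq> {} \<longleftrightarrow> adj G u v"
    using assms unfolding outerstring_def by blast
  have fC: "f u \<in> C" if "u \<in> verts G" for u using C(2) that by (auto simp: bij_betw_def)
  obtain c where c: "\<forall>S\<in>C. \<exists>g. arc g \<and> path_image g = S \<and> (Im (pathstart g) = c \<or> Im (pathfinish g) = c)"
    and half: "(\<forall>S\<in>C. S \<subseteq> {z. Im z \<ge> c}) \<or> (\<forall>S\<in>C. S \<subseteq> {z. Im z \<le> c})"
    using C(1) unfolding grounded_def by (elim exE conjE)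
  \<comment> \<open>The sign \<open>s\<close> treats upper and lower half-planes at once.\<close>
  have "\<exists>s::real. s \<in> {1, -1} \<and> (\<forall>S\<in>C. \<forall>z\<in>S. s * c \<le> s * Im z)"
    using half
  proof
    assume "\<forall>S\<in>C. S \<subseteq> {z. Im z \<ge> c}"
    then show ?thesis by (intro exI[of _ 1]) auto
  next
    assume "\<forall>S\<in>C. S \<subseteq> {z. Im z \<le> c}"
    then show ?thesis by (intro exI[of _ "-1"]) auto
  qed
  then obtain s :: real where s: "s \<in> {1, -1}" "\<And>S z. S \<in> C \<Longrightarrow> z \<in> S \<Longrightarrow> s * c \<le> s * Im z" by blast
  have "\<forall>u\<in>verts G. path_connected (f u) \<and> (\<exists>z\<in>f u. Im z = c)"
  proof
    fix u assume "u \<in> verts G"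
    then obtain h where h: "arc h" "path_image h = f u" "Im (pathstart h) = c \<or> Im (pathfinish h) = c"
      using c fC by blast
    then have "path_connected (f u)" using path_connected_path_image[of h] arc_imp_path by auto
    moreover have "pathstart h \<in> f u" "pathfinish h \<in> f u" using h(2) by auto
    ultimately show "path_connected (f u) \<and> (\<exists>z\<in>f u. Im z = c)" using h(3) by blast
  qed
  then obtain P where pc: "\<And>u. u \<in> verts G \<Longrightarrow> path_connected (f u)"
    and P: "\<And>u. u \<in> verts G \<Longrightarrow> P u \<in> f u" "\<And>u. u \<in> verts G \<Longrightarrow> Im (P u) = c" by metis
  have path: "\<exists>p. path p \<and> path_image p \<subseteq> (\<Union>t\<in>set S. f t) \<and> pathstart p = P u \<and> pathfinish p = P u'"
    if S: "set S \<subseteq> verts G" "successively (adj G) S" "u \<in> set S" "u' \<in> set S" for S u u'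
  proof -
    have "successively (\<lambda>s t. f s \<inter> f t \<noteq> {}) S"
    proof (rule successively_mono[OF S(2)])
      fix s t assume "s \<in> set S" "t \<in> set S" "adj G s t"
      then show "f s \<inter> f t \<noteq> {}" using S(1) adj[of s t] P(1)[of s] by (cases "s = t") auto
    qed
    then have "path_connected (\<Union>t\<in>set S. f t)"
      using S(1) pc by (intro path_connected_UN_successively) auto
    then have *: "\<forall>x\<in>\<Union>t\<in>set S. f t. \<forall>y\<in>\<Union>t\<in>set S. f t.
        \<exists>p. path p \<and> path_image p \<subseteq> (\<Union>t\<in>set S. f t) \<and> pathstart p = x \<and> pathfinish p = y"
      by (simp only: path_connected_def)
    have "P u \<in> (\<Union>t\<in>set S. f t)" "P u' \<in> (\<Union>t\<in>set S. f t)"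
      using P(1) S by (meson UN_I subsetD)+
    then show ?thesis by (rule *[THEN bspec, THEN bspec])
  qed
  show thesis
  proof (rule that[of "\<lambda>u. Re (P u)"])
    fix u w assume uw: "u \<in> verts G" "w \<in> verts G" "u \<noteq> w" "\<not> adj G u w"
    then have "f u \<inter> f w = {}" using adj[OF uw(1-3)] by simp
    then have "P u \<noteq> P w" using P(1)[OF uw(1)] P(1)[OF uw(2)] by auto
    then show "Re (P u) \<noteq> Re (P w)" using P uw by (auto simp: complex_eq_iff)
  next
    fix S T u u' w w'
    assume S: "set S \<subseteq> verts G" "successively (adj G) S" "u \<in> set S" "u' \<in> set S"
      and T: "set T \<subseteq> verts G" "successively (adj G) T" "w \<in> set T" "w' \<in> set T"
      and anti: "\<forall>s\<in>set S. \<forall>t\<in>set T. s \<noteq> t \<and> \<not> adj G s t"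
    obtain p where p: "path p" "path_image p \<subseteq> (\<Union>t\<in>set S. f t)" "pathstart p = P u" "pathfinish p = P u'"
      using path[OF S] by blast
    obtain q where q: "path q" "path_image q \<subseteq> (\<Union>t\<in>set T. f t)" "pathstart q = P w" "pathfinish q = P w'"
      using path[OF T] by blast
    show "\<not> (Re (P u) < Re (P w) \<and> Re (P w) < Re (P u') \<and> Re (P u') < Re (P w'))"
    proof
      assume order: "Re (P u) < Re (P w) \<and> Re (P w) < Re (P u') \<and> Re (P u') < Re (P w')"
      have half': "s * c \<le> s * Im z" if "z \<in> path_image p \<union> path_image q" for z
      proof -
        have "z \<in> (\<Union>t\<in>set S. f t) \<union> (\<Union>t\<in>set T. f t)"
          using subsetD[OF p(2)] subsetD[OF q(2)] that by blast
        then obtain t where "t \<in> set S \<union> set T" "z \<in> f t" by auto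
        then show ?thesis using s(2)[OF fC, of t z] S(1) T(1) by auto
      qed
      have "u \<in> verts G" "u' \<in> verts G" "w \<in> verts G" "w' \<in> verts G" using S T by auto
      then have "path_image p \<inter> path_image q \<noteq> {}"
      proof (intro fashoda_half_plane[of s p q c])
        show "s \<in> {1, -1}" "path p" "path q" by fact+
        show "s * c \<le> s * Im z" if "z \<in> path_image p \<union> path_image q" for z using that by (rule half')
        show "Re (pathstart p) < Re (pathstart q)" "Re (pathstart q) < Re (pathfinish p)"
          "Re (pathfinish p) < Re (pathfinish q)"
          unfolding p(3,4) q(3,4) using order by blast+
      qed (unfold p(3,4) q(3,4), (rule P(2), assumption)+)
      then obtain z where "z \<in> path_image p" "z \<in> path_image q" by blast
      then have "z \<in> (\<Union>t\<in>set S. f t)" "z \<in> (\<Union>t\<in>set T. f t)"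
        by (blast intro: subsetD[OF p(2)] subsetD[OF q(2)])+
      then obtain a b where z: "z \<in> f a" "z \<in> f b" and ab: "a \<in> set S" "b \<in> set T" by auto
      have "a \<noteq> b \<and> \<not> adj G a b" using anti ab by simp
      then show False using adj[of a b] z ab S(1) T(1) by auto
    qed
  qed
qed

text \<open>In sorted order, the first and third point interlace with the second and fourth.
  \<open>I\<close> allows swaps within a pair but puts the leftmost point into the first pair; so
  each of the three pairings is listed in both orders.\<close>

lemma four_points_interlace:
  fixes p q r s :: real
  assumes "distinct [p, q, r, s]"
  defines "I \<equiv> \<lambda>u u' w w' :: real. u < w \<and> w < u' \<and> u' < w' \<or> u' < w \<and> w < u \<and> u < w' \<or>
    u < w' \<and> w' < u' \<and> u' < w \<or> u' < w' \<and> w' < u \<and> u < w"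
  shows "I p q r s \<or> I r s p q \<or> I p r q s \<or> I q s p r \<or> I p s q r \<or> I q r p s"
  using assms(1) unfolding I_def distinct.simps list.set by (smt (verit) insert_iff)

lemma successively_join:
  assumes "successively P (xs @ hs)" "successively P (hs @ ys)"
    "hs = [] \<Longrightarrow> xs \<noteq> [] \<Longrightarrow> ys \<noteq> [] \<Longrightarrow> P (last xs) (hd ys)"
  shows "successively P (xs @ hs @ ys)"
  using assms by (cases "hs = []") (auto simp: successively_append_iff)

text \<open>Take one vertex far from the ends on each of the three paths, and a fourth vertex \<open>h\<close> at the first hub.
  In each pairing of the four, one pair is joined through the first hub and the other through the
  second, so that no pairing interlaces on the grounding line.\<close>

lemma web_imp_not_outerstring:
  assumes sym: "symp (adj G)" "irreflp (adj G)" and web: "web (adj G) H A B C H'"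
    and V: "set (H @ A @ B @ C @ H') \<subseteq> verts G"
  shows "\<not> outerstring G"
proof
  assume "outerstring G"
  then obtain g :: "'a \<Rightarrow> real" where
    ne: "\<And>u w. u \<in> verts G \<Longrightarrow> w \<in> verts G \<Longrightarrow> u \<noteq> w \<Longrightarrow> \<not> adj G u w \<Longrightarrow> g u \<noteq> g w"
    and nc: "\<And>S T u u' w w'. set S \<subseteq> verts G \<Longrightarrow> set T \<subseteq> verts G \<Longrightarrow> successively (adj G) S \<Longrightarrow> successively (adj G) T \<Longrightarrow>
       \<forall>s\<in>set S. \<forall>t\<in>set T. s \<noteq> t \<and> \<not> adj G s t \<Longrightarrow> u \<in> set S \<Longrightarrow> u' \<in> set S \<Longrightarrow> w \<in> set T \<Longrightarrow> w' \<in> set T \<Longrightarrow>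
       \<not> (g u < g w \<and> g w < g u' \<and> g u' < g w')"
    by (rule outerstring_noncrossing) blast
  have lens: "4 \<le> length A" "4 \<le> length B" "4 \<le> length C" "length H \<le> 1" "length H' \<le> 1"
    and ip: "ipath (adj G) (H @ A @ H')" "ipath (adj G) (H @ B @ H')" "ipath (adj G) (H @ C @ H')"
    and cr: "cross (adj G) (H = []) (H' = []) A B" "cross (adj G) (H = []) (H' = []) A C" "cross (adj G) (H = []) (H' = []) B C"
    using web by (auto simp: web_def)
  have E: "adj G u w \<longleftrightarrow> adj G w u" "\<not> adj G u u" for u w
    using sym by (auto simp: symp_def irreflp_def)
  \<comment> \<open>With an empty hub, a corner of its triangle takes the place of the hub vertex.
    The choice of the corner on \<open>A\<close> is matched by the order inside the triples of
    \<open>?D\<close>.\<close>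
  define h where "h = (if H = [] then hd A else hd H)"
  \<comment> \<open>Why four vertices: \<open>X ! 2\<close> has to avoid \<open>X ! 0\<close>, which
    may be \<open>h\<close> itself, and its neighbour \<open>X ! 1\<close>, and must not be the last
    vertex, which may touch the second hub.\<close>
  have long: "\<exists>x0 x1 x2 x3 Xr. X = x0 # x1 # x2 # x3 # Xr" if "4 \<le> length X" for X :: "'a list"
    using that by (cases X; cases "tl X"; cases "tl (tl X)"; cases "tl (tl (tl X))") auto
  have crs: "cross (adj G) s t Y X" if "cross (adj G) s t X Y" for s t X Y
    using that E(1) unfolding cross_def by (simp add: Int_commute) blast
  let ?D = "{(A, B, C), (B, A, C), (C, A, B)}"
  have "\<not> (g u < g w \<and> g w < g u' \<and> g u' < g w') \<and> \<not> (g w < g u \<and> g u < g w' \<and> g w' < g u') \<and>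
      g h \<noteq> g (X ! 2) \<and> g h \<noteq> g (Y ! 2) \<and> g (Z ! 2) \<noteq> g (X ! 2) \<and> g (Z ! 2) \<noteq> g (Y ! 2)"
    if D: "(Z, X, Y) \<in> ?D" and uw: "{u, u'} = {h, Z ! 2}" "{w, w'} = {X ! 2, Y ! 2}" for X Y Z u u' w w'
  proof -
    have "4 \<le> length Z" "4 \<le> length X" "4 \<le> length Y" using D lens by auto
    from this[THEN long] obtain z0 z1 z2 z3 Zr x0 x1 x2 x3 Xr y0 y1 y2 y3 Yr
      where Z: "Z = z0 # z1 # z2 # z3 # Zr" and X: "X = x0 # x1 # x2 # x3 # Xr"
        and Y: "Y = y0 # y1 # y2 # y3 # Yr" by blast
    have iZ: "ipath (adj G) (H @ Z @ H')" and iX: "ipath (adj G) (H @ X @ H')" and iY: "ipath (adj G) (H @ Y @ H')"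
      using D ip by auto
    have cZX: "cross (adj G) (H = []) (H' = []) Z X" and cZY: "cross (adj G) (H = []) (H' = []) Z Y"
      and cXY: "cross (adj G) (H = []) (H' = []) X Y"
      using D cr cr[THEN crs] by auto
    \<comment> \<open>\<open>S\<close> leads from \<open>h\<close> to \<open>Z ! 2\<close>; the case
      \<open>h = z0\<close> arises when the first hub is empty and \<open>Z = A\<close>.
      \<open>T\<close> leads from \<open>X ! 2\<close> through the second hub to
      \<open>Y ! 2\<close>.\<close>
    define S where "S = (if h = z0 then [z0, z1, z2] else [h, z0, z1, z2])"
    define T where "T = (x2 # x3 # Xr) @ H' @ rev (y2 # y3 # Yr)"
    have h: "h = z0 \<or> adj G h z0"
    proof (cases "H = []")
      case True
      then show ?thesis
      proof (cases "Z = A")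
        case False
        then have "cross (adj G) (H = []) (H' = []) A Z" using D cr by auto
        moreover have "hd A \<in> set A" using lens by (cases A) auto
        ultimately show ?thesis using True by (auto simp: cross_def Z h_def)
      qed (use True Z in \<open>auto simp: h_def\<close>)
    next
      case False
      then obtain h' where "H = [h']" using lens by (cases H) auto
      then show ?thesis using iZ by (simp add: Z h_def)
    qed
    have sS: "successively (adj G) S"
      using iZ h by (auto simp: S_def Z ipath_append)
    have sT: "successively (adj G) T"
    proof -
      have 1: "successively (adj G) ((x2 # x3 # Xr) @ H')"
        using ipath_successively[OF iX] by (auto simp: X successively_append_iff successively_Cons)
      have yH: "successively (\<lambda>u w. adj G w u) ((y2 # y3 # Yr) @ H')"
        using ipath_successively[OF iY] E(1) by (auto simp: Y successively_append_iff successively_Cons)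
      have "rev H' = H'" using lens by (cases H') auto
      then have eq: "H' @ rev (y2 # y3 # Yr) = rev ((y2 # y3 # Yr) @ H')" by (simp only: rev_append)
      have 2: "successively (adj G) (H' @ rev (y2 # y3 # Yr))"
        unfolding eq successively_rev by (rule yH)
      have "adj G (last (x2 # x3 # Xr)) (hd (rev (y2 # y3 # Yr)))" if "H' = []"
        using cXY that unfolding hd_rev by (auto simp: cross_def X Y)
      then show ?thesis unfolding T_def by (intro successively_join 1 2)
    qed
    have tails: "set T = set (x2 # x3 # Xr) \<union> set (y2 # y3 # Yr) \<union> set H'" by (auto simp: T_def)
    have dX: "ipath (adj G) X" "ipath (adj G) Y" "ipath (adj G) Z"
      using iX iY iZ by (simp_all add: ipath_append)
    have lastZ: "last Z \<notin> {z0, z1, z2}"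
    proof -
      have "last Z \<in> set (z3 # Zr)" by (simp add: Z)
      then show ?thesis using dX(3) by (auto simp: Z simp del: last.simps)
    qed
    have ZW: "z \<noteq> t \<and> \<not> adj G z t"
      if "z \<in> {z0, z1, z2}" "t \<in> set (w2 # w3 # Wr)" "cross (adj G) (H = []) (H' = []) Z W"
        "ipath (adj G) W" "W = w0 # w1 # w2 # w3 # Wr" for z t W w0 w1 w2 w3 Wr
    proof -
      have "t \<noteq> hd W" using that(2,4,5) by auto
      moreover have "z \<noteq> last Z" using that(1) lastZ by metis
      moreover have "z \<in> set Z" "t \<in> set W" using that(1,2,5) by (auto simp: Z)
      ultimately show ?thesis using that(3) unfolding cross_def by (metis disjoint_iff)
    qed
    have ZH': "z \<noteq> t \<and> \<not> adj G z t" if "z \<in> {z0, z1, z2}" "t \<in> set H'" for z t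
    proof -
      have "ipath (adj G) (Z @ H')" using iZ by (simp add: ipath_append)
      moreover have "z \<in> set Z" using that(1) by (auto simp: Z)
      moreover have "z \<noteq> last Z" using that(1) lastZ by metis
      ultimately show ?thesis using that(2) unfolding ipath_append by (metis disjoint_iff)
    qed
    have ZT: "z \<noteq> t \<and> \<not> adj G z t" if "z \<in> {z0, z1, z2}" "t \<in> set T" for z t
      using that(2) ZW[OF that(1) _ cZX dX(1) X] ZW[OF that(1) _ cZY dX(2) Y] ZH'[OF that(1)]
      unfolding tails by blast
    have hT: "h \<noteq> t \<and> \<not> adj G h t" if ht: "h \<noteq> z0" "t \<in> set T" for t
    proof (cases "H = []")
      case True
      \<comment> \<open>In \<open>?D\<close> the list \<open>A\<close> is \<open>Z\<close> or
        \<open>X\<close>, and \<open>h \<noteq> z0\<close> rules out \<open>Z = A\<close>. Hence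
        \<open>h\<close> is the first vertex of \<open>X\<close>, two steps before the start of
        \<open>T\<close>.\<close>
      then have XA: "X = A" "h = hd A" using D that(1) Z by (auto simp: h_def)
      have "last X \<in> set (x3 # Xr)" by (simp add: X)
      moreover have "x0 \<notin> set (x3 # Xr)" using dX(1) by (simp add: X)
      ultimately have hX: "h = x0" "h \<in> set X" "h \<noteq> last X" using XA X by fastforce+
      consider "t \<in> set (x2 # x3 # Xr)" | "t \<in> set (y2 # y3 # Yr)" | "t \<in> set H'"
        using ht(2) unfolding tails by blast
      then show ?thesis
      proof cases
        case 1
        then show ?thesis using dX(1) hX(1) by (auto simp: X)
      next
        case 2
        moreover have "t \<noteq> hd Y" "t \<in> set Y" using 2 dX(2) by (auto simp: Y)
        ultimately show ?thesis using cXY hX(2,3) unfolding cross_def by (metis disjoint_iff)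
      next
        case 3
        have "ipath (adj G) (X @ H')" using iX by (simp add: ipath_append)
        then show ?thesis using 3 hX(2,3) unfolding ipath_append by (metis disjoint_iff)
      qed
    next
      case False
      then have H: "H = [h]" using lens by (cases H) (auto simp: h_def)
      have "t \<in> set (X @ H') \<and> t \<noteq> hd (X @ H') \<or> t \<in> set (Y @ H') \<and> t \<noteq> hd (Y @ H')"
        using that(2) iX iY unfolding tails by (auto simp: X Y ipath_append)
      then show ?thesis using iX iY unfolding H by auto
    qed
    have anti: "\<forall>s\<in>set S. \<forall>t\<in>set T. s \<noteq> t \<and> \<not> adj G s t"
    proof (intro ballI)
      fix s t assume s: "s \<in> set S" and t: "t \<in> set T"
      show "s \<noteq> t \<and> \<not> adj G s t"
      proof (cases "s \<in> {z0, z1, z2}")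
        case True
        then show ?thesis using t by (rule ZT)
      next
        case False
        then have "s = h" "h \<noteq> z0" using s by (auto simp: S_def split: if_splits)
        then show ?thesis using hT t by simp
      qed
    qed
    have "h \<in> verts G" using V lens by (cases A; cases H) (auto simp: h_def)
    then have VS: "set S \<subseteq> verts G" "set T \<subseteq> verts G"
      using V D by (auto simp: S_def T_def X Y Z)
    have m: "u \<in> set S" "u' \<in> set S" "w \<in> set T" "w' \<in> set T"
      using uw by (auto simp: S_def T_def X Y Z doubleton_eq_iff)
    have anti': "\<forall>t\<in>set T. \<forall>s\<in>set S. t \<noteq> s \<and> \<not> adj G t s" using anti E(1) by metis
    have "g a \<noteq> g b" if "a \<in> set S" "b \<in> set T" for a b
      using ne[of a b] anti that VS by blast
    moreover have "h \<in> set S" "Z ! 2 \<in> set S" "X ! 2 \<in> set T" "Y ! 2 \<in> set T"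
      by (auto simp: S_def T_def X Y Z)
    ultimately show ?thesis
      using nc[OF VS sS sT anti m] nc[OF VS(2,1) sT sS anti' m(3,4,1,2)] by blast
  qed
  note I = this
  have "distinct [g h, g (A ! 2), g (B ! 2), g (C ! 2)]"
    using I[of A B C h "A ! 2" "B ! 2" "C ! 2"] I[of B A C h "B ! 2" "A ! 2" "C ! 2"] by auto
  \<comment> \<open>The three triples of \<open>?D\<close> are the three ways to pair
    \<open>h\<close> with one of the other vertices.\<close>
  from four_points_interlace[OF this] show False
    using I[of A B C] I[of B A C] I[of C A B] by (smt (verit) insert_iff insert_commute)
qed

section \<open>Distances and rooted covers\<close>

lemma length_vwalk_to_vpath: "length (vwalk_to_vpath p) \<le> length p"
proof (induction p rule: vwalk_to_vpath.induct)
  case (2 x xs)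
  then show ?case
    using length_dropWhile_le[of "\<lambda>y. y \<noteq> x" xs] by (auto simp del: length_dropWhile_le)
qed simp

text \<open>\<open>gdist\<close> minimises over paths; removing the repetitions from a walk gives a
  path that is no longer, so walks bound the distance as well.\<close>

lemma gdist_le_vwalk:
  assumes "vwalk p G" shows "gdist G (hd p) (last p) \<le> length p - 1"
proof -
  let ?q = "vwalk_to_vpath p"
  have "gdist G (hd p) (last p) \<le> vwalk_length ?q"
    unfolding gdist_def
    by (rule Least_le) (use assms in \<open>auto intro!: exI[of _ ?q] simp: vwalk_to_vpath_hd vwalk_to_vpath_last vwalk_to_vpath_vpath\<close>)
  then show ?thesis using length_vwalk_to_vpath[of p] by simp
qed

lemma vwalk_join:
  assumes "vwalk p G" "vwalk q G" "last p = hd q"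
  shows "vwalk (p @ tl q) G" "hd (p @ tl q) = hd p" "last (p @ tl q) = last q"
  using assms by (cases q; auto simp: vwalk_iff_successively successively_append_iff successively_Cons)+

section \<open>Shortest paths in a connected graph\<close>

locale connected_graph = Digraph.graph G for G :: "('a, 'b) pre_digraph" +
  assumes connected: "Digraph_Component.connected G"
begin

abbreviation d where "d \<equiv> gdist G"

lemma adj_sym: "adj G u w \<longleftrightarrow> adj G w u"
  using adj_symp[of G] by (auto simp: symp_def graph_axioms)

lemma isometric_path_exists:
  assumes "u \<in> verts G" "w \<in> verts G"
  obtains p where "isometric_path G p" "hd p = u" "last p = w"
  using gdist_attained[OF _ connected assms] graph_axioms by auto

lemma isometric_pathD:
  assumes "isometric_path G p"
  shows "vwalk p G" "distinct p" "p \<noteq> []" "set p \<subseteq> verts G" "length p = Suc (d (hd p) (last p))"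
  using assms by (cases p; auto simp: isometric_path_def vpath_def vwalk_def)+

lemma d_triangle:
  assumes "u \<in> verts G" "w \<in> verts G" "z \<in> verts G"
  shows "d u z \<le> d u w + d w z"
proof -
  obtain p where p: "isometric_path G p" "hd p = u" "last p = w" by (rule isometric_path_exists[OF assms(1,2)])
  obtain q where q: "isometric_path G q" "hd q = w" "last q = z" by (rule isometric_path_exists[OF assms(2,3)])
  have "vwalk (p @ tl q) G" "hd (p @ tl q) = u" "last (p @ tl q) = z"
    using vwalk_join[OF isometric_pathD(1)[OF p(1)] isometric_pathD(1)[OF q(1)]] p q by simp_all
  then show ?thesis
    using gdist_le_vwalk[of "p @ tl q" G] isometric_pathD(3,5)[OF p(1)] isometric_pathD(3,5)[OF q(1)] p(2,3) q(2,3) by simp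
qed

lemma vwalk_rev: "vwalk (rev p) G \<longleftrightarrow> vwalk p G"
  unfolding vwalk_iff_successively by (simp add: adj_sym)

lemma d_sym:
  assumes "u \<in> verts G" "w \<in> verts G"
  shows "d u w = d w u"
proof -
  have "d b a \<le> d a b" if ab: "a \<in> verts G" "b \<in> verts G" for a b
  proof -
    obtain p where p: "isometric_path G p" "hd p = a" "last p = b" by (rule isometric_path_exists[OF ab])
    then show ?thesis
      using gdist_le_vwalk[of "rev p" G] isometric_pathD[OF p(1)] by (simp add: vwalk_rev hd_rev last_rev)
  qed
  then show ?thesis using assms by (simp add: le_antisym)
qed

lemma d_self: "u \<in> verts G \<Longrightarrow> d u u = 0"
  using gdist_le_vwalk[of "[u]" G] by (simp add: vwalk_iff_successively)

lemma adj_verts: "adj G u w \<Longrightarrow> u \<in> verts G \<and> w \<in> verts G"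
  by (auto simp: arcs_ends_conv)

lemma d_adj: "adj G u w \<Longrightarrow> d u w \<le> 1"
  using gdist_le_vwalk[of "[u, w]" G] adj_verts[of u w] by (simp add: vwalk_iff_successively)

lemma d_vwalk_nth:
  assumes "vwalk p G" "i \<le> j" "j < length p"
  shows "d (p ! i) (p ! j) \<le> j - i"
  using assms(2,3)
proof (induction j rule: dec_induct)
  case base
  then show ?case using assms(1) by (simp add: d_self vwalk_iff_successively subset_eq)
next
  case (step j)
  have "adj G (p ! j) (p ! Suc j)" using assms(1) step.prems successively_nth[of "adj G" p j]
    by (simp add: vwalk_iff_successively)
  moreover have "p ! i \<in> verts G" using assms(1) step by (auto simp: vwalk_iff_successively)
  ultimately show ?case
    using d_triangle[of "p ! i" "p ! j" "p ! Suc j"] adj_verts[of "p ! j" "p ! Suc j"] d_adj[of "p ! j" "p ! Suc j"] step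
    by simp
qed

text \<open>The distances from the start to index \<open>i\<close>, from \<open>i\<close> to
  \<open>j\<close> and from \<open>j\<close> to the end are at most the index differences, and by
  the triangle inequality they sum to at least the whole length; so all three bounds are
  attained.\<close>

lemma isometric_nth:
  assumes P: "isometric_path G P" and ij: "i \<le> j" "j < length P"
  shows "d (P ! i) (P ! j) = j - i"
proof -
  note PD = isometric_pathD[OF P]
  have V: "P ! k \<in> verts G" if "k < length P" for k using PD(4) that by auto
  have "d (P ! 0) (P ! (length P - 1)) = length P - 1"
    using PD(3,5) by (simp add: hd_conv_nth last_conv_nth)
  moreover have "d (P ! 0) (P ! i) \<le> i" "d (P ! i) (P ! j) \<le> j - i" "d (P ! j) (P ! (length P - 1)) \<le> length P - 1 - j"
    using d_vwalk_nth[OF PD(1), of 0 i] d_vwalk_nth[OF PD(1), of i j] d_vwalk_nth[OF PD(1), of j "length P - 1"] ij by auto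
  moreover have "d (P ! 0) (P ! (length P - 1)) \<le> d (P ! 0) (P ! i) + d (P ! i) (P ! (length P - 1))"
    "d (P ! i) (P ! (length P - 1)) \<le> d (P ! i) (P ! j) + d (P ! j) (P ! (length P - 1))"
    using ij by (auto intro!: d_triangle V)
  ultimately show ?thesis using ij by linarith
qed

text \<open>A repeated vertex would allow a closed piece to be cut out, making the distance of the
  ends smaller than the length.\<close>

lemma isometric_if_vwalk:
  assumes "vwalk p G" "length p = Suc (d (hd p) (last p))"
  shows "isometric_path G p"
proof -
  have p: "p \<noteq> []" "set p \<subseteq> verts G" using assms by (auto simp: vwalk_iff_successively)
  have "p ! i \<noteq> p ! j" if ij: "i < j" "j < length p" for i j
  proof
    assume eq: "p ! i = p ! j"
    have "d (p ! 0) (p ! (length p - 1)) = length p - 1" using assms(2) p(1) by (simp add: hd_conv_nth last_conv_nth)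
    moreover have "d (p ! 0) (p ! (length p - 1)) \<le> d (p ! 0) (p ! i) + d (p ! j) (p ! (length p - 1))"
      unfolding eq[symmetric] using p ij by (intro d_triangle) auto
    moreover have "d (p ! 0) (p ! i) \<le> i" "d (p ! j) (p ! (length p - 1)) \<le> length p - 1 - j"
      using d_vwalk_nth[OF assms(1), of 0 i] d_vwalk_nth[OF assms(1), of j "length p - 1"] ij by auto
    ultimately show False using ij by linarith
  qed
  then have "distinct p" by (metis distinct_conv_nth linorder_neqE_nat)
  then show ?thesis using assms by (auto simp: isometric_path_def vpath_def)
qed

section \<open>Covers by rooted isometric paths\<close>

text \<open>A geodesic between the root and the nearer end prolongs the segment to a walk as long as
  the distance of the farther end from \<open>v\<close>, hence to an isometric path.\<close>

lemma rooted_segment: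
  assumes P: "isometric_path G P" and ij: "i \<le> j" "j < length P" and v: "v \<in> verts G"
    and mono: "d v (P ! i) = d v (P ! j) + (j - i) \<or> d v (P ! j) = d v (P ! i) + (j - i)"
  shows "\<exists>q. isometric_path G q \<and> rooted v q \<and> (\<forall>k. i \<le> k \<and> k \<le> j \<longrightarrow> P ! k \<in> set q)"
proof -
  note PD = isometric_pathD[OF P]
  have V: "P ! k \<in> verts G" if "k < length P" for k using PD(4) that by auto
  define S where "S = take (Suc (j - i)) (drop i P)"
  have len: "length S = Suc (j - i)" using ij by (simp add: S_def)
  have nthS: "S ! k = P ! (i + k)" if "k \<le> j - i" for k using that ij by (simp add: S_def)
  have "set S \<subseteq> set P" unfolding S_def by (meson order_trans set_take_subset set_drop_subset)
  moreover have "successively (adj G) S"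
    unfolding successively_conv_nth
  proof (intro allI impI)
    fix k assume "Suc k < length S"
    then show "adj G (S ! k) (S ! Suc k)"
      using PD(1) ij successively_nth[of "adj G" P "i + k"] by (simp add: len nthS vwalk_iff_successively)
  qed
  ultimately have S: "vwalk S G" using PD(4) len by (auto simp: vwalk_iff_successively)
  have "S \<noteq> []" using len by auto
  then have ends: "hd S = P ! i" "last S = P ! j"
    using nthS[of 0] nthS[of "j - i"] len ij by (simp_all add: hd_conv_nth last_conv_nth)
  have inS: "P ! k \<in> set S" if "i \<le> k \<and> k \<le> j" for k
  proof -
    have "k - i \<le> j - i" "i + (k - i) = k" using that by auto
    then show ?thesis using nthS[of "k - i"] len nth_mem[of "k - i" S] by simp
  qed
  show ?thesis
    using mono
  proof
    assume *: "d v (P ! i) = d v (P ! j) + (j - i)"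
    obtain R where R: "isometric_path G R" "hd R = P ! j" "last R = v"
      by (rule isometric_path_exists[OF V[OF ij(2)] v])
    note J = vwalk_join[OF S isometric_pathD(1)[OF R(1)]]
    have "isometric_path G (S @ tl R)"
      using J R ends len * isometric_pathD(3,5)[OF R(1)] ij V v d_sym[of v "P ! i"] d_sym[of v "P ! j"]
      by (intro isometric_if_vwalk) auto
    moreover have "rooted v (S @ tl R)" using J R ends by (simp add: rooted_def)
    ultimately show ?thesis using inS by (intro exI[of _ "S @ tl R"]) auto
  next
    assume *: "d v (P ! j) = d v (P ! i) + (j - i)"
    obtain R where R: "isometric_path G R" "hd R = v" "last R = P ! i"
      by (rule isometric_path_exists[OF v V[OF order.strict_trans1[OF ij]]])
    note J = vwalk_join[OF isometric_pathD(1)[OF R(1)] S]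
    have "isometric_path G (R @ tl S)"
      using J R ends len * isometric_pathD(3,5)[OF R(1)] ij
      by (intro isometric_if_vwalk) auto
    moreover have "rooted v (R @ tl S)" using J R ends by (simp add: rooted_def)
    moreover have "set S \<subseteq> set (R @ tl S)"
      using R ends isometric_pathD(3)[OF R(1)] last_in_set[of R] len by (cases S) auto
    ultimately show ?thesis using inS by (intro exI[of _ "R @ tl S"]) blast
  qed
qed

text \<open>If \<open>f\<close> gives the distances of the vertices of an isometric path from the root, then
  \<open>skew f a b\<close> says that the vertices with indices \<open>a < b\<close> lie on no common rooted isometric path.\<close>

definition skew :: "(nat \<Rightarrow> nat) \<Rightarrow> nat \<Rightarrow> nat \<Rightarrow> bool" where
  "skew f a b \<longleftrightarrow> a < b \<and> f a + a < f b + b \<and> f b + a < f a + b"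

text \<open>Triangle inequalities written without subtraction of naturals: for
  \<open>f i = d v (P ! i)\<close>, the value \<open>f i + i\<close> does not decrease and
  \<open>f i - i\<close> does not increase along the path.\<close>

lemma lipschitz:
  assumes P: "isometric_path G P" and v: "v \<in> verts G" and ab: "a \<le> b" "b < length P"
  shows "d v (P ! a) + a \<le> d v (P ! b) + b" "d v (P ! b) + a \<le> d v (P ! a) + b"
proof -
  have V: "P ! a \<in> verts G" "P ! b \<in> verts G" using isometric_pathD(4)[OF P] ab by auto
  then show "d v (P ! a) + a \<le> d v (P ! b) + b" "d v (P ! b) + a \<le> d v (P ! a) + b"
    using d_triangle[of v "P ! b" "P ! a"] d_triangle[of v "P ! a" "P ! b"] v
      isometric_nth[OF P ab] d_sym[of "P ! a" "P ! b"] ab by auto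
qed

text \<open>Greedy choice: the segment from \<open>a\<close> up to just before the first index
  \<open>b\<close> skew to \<open>a\<close> lies on one rooted path, and the induction continues at
  \<open>b\<close> with one path less. If there is no such \<open>b\<close>, one path covers the
  rest.\<close>

lemma coverable_or_skew_sequence:
  assumes P: "isometric_path G P" and v: "v \<in> verts G"
  shows "rooted_coverable G v k {P ! i | i. a \<le> i \<and> i < length P} \<or>
    (\<exists>x. x 0 = a \<and> x k < length P \<and> (\<forall>i<k. skew (\<lambda>i. d v (P ! i)) (x i) (x (Suc i))))"
proof (induction k arbitrary: a)
  case 0
  show ?case
  proof (cases "a < length P")
    case False
    then have "{P ! i | i. a \<le> i \<and> i < length P} = {}" by auto
    then show ?thesis unfolding rooted_coverable_def by (intro disjI1 exI[of _ "{}"]) simp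
  qed auto
next
  case (Suc k)
  let ?f = "\<lambda>i. d v (P ! i)"
  \<comment> \<open>By \<open>lipschitz\<close>, failing to be skew turns one of the two
    inequalities into an equality, so the distance from \<open>v\<close> changes by the full
    \<open>b - a\<close> between the ends of the segment.\<close>
  have seg: "\<exists>q. isometric_path G q \<and> rooted v q \<and> (\<forall>i. a \<le> i \<and> i \<le> b \<longrightarrow> P ! i \<in> set q)"
    if "a \<le> b" "b < length P" "\<not> skew ?f a b" for b
    using that lipschitz[OF P v that(1,2)] by (intro rooted_segment P v that) (auto simp: skew_def)
  show ?case
  proof (cases "\<exists>b<length P. skew ?f a b")
    case True
    then obtain b where b: "b < length P \<and> skew ?f a b" "\<forall>c<b. \<not> (c < length P \<and> skew ?f a c)"
      using exists_least_iff[of "\<lambda>b. b < length P \<and> skew ?f a b"] by blast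
    then have ab: "a < b" by (simp add: skew_def)
    from Suc.IH[of b] show ?thesis
    proof
      assume "rooted_coverable G v k {P ! i | i. b \<le> i \<and> i < length P}"
      then obtain Q where Q: "finite Q" "card Q \<le> k" "\<forall>q\<in>Q. isometric_path G q \<and> rooted v q"
        "{P ! i | i. b \<le> i \<and> i < length P} \<subseteq> (\<Union>q\<in>Q. set q)"
        unfolding rooted_coverable_def by blast
      obtain q where q: "isometric_path G q" "rooted v q" "\<And>i. a \<le> i \<Longrightarrow> i \<le> b - 1 \<Longrightarrow> P ! i \<in> set q"
      proof -
        have "b - 1 < b" "a \<le> b - 1" "b - 1 < length P" using b ab by auto
        then show thesis using seg[of "b - 1"] b(2) that by blast
      qed
      have "{P ! i | i. a \<le> i \<and> i < length P} \<subseteq> (\<Union>q\<in>insert q Q. set q)"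
      proof clarify
        fix i assume i: "a \<le> i" "i < length P"
        show "P ! i \<in> (\<Union>q\<in>insert q Q. set q)"
        proof (cases "b \<le> i")
          case True
          then have "P ! i \<in> (\<Union>q\<in>Q. set q)" using i Q(4) by blast
          then show ?thesis by simp
        next
          case False
          then show ?thesis using q(3)[of i] i by simp
        qed
      qed
      then have "rooted_coverable G v (Suc k) {P ! i | i. a \<le> i \<and> i < length P}"
        unfolding rooted_coverable_def
      proof (intro exI[of _ "insert q Q"] conjI)
        show "finite (insert q Q)" "card (insert q Q) \<le> Suc k" using Q(1,2) by (simp_all add: card_insert_if)
        show "\<forall>p\<in>insert q Q. isometric_path G p \<and> rooted v p" using Q(3) q(1,2) by simp
      qed
      then show ?thesis ..
    next
      assume "\<exists>x. x 0 = b \<and> x k < length P \<and> (\<forall>i<k. skew ?f (x i) (x (Suc i)))"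
      then obtain x where x: "x 0 = b" "x k < length P" "\<forall>i<k. skew ?f (x i) (x (Suc i))" by blast
      define y where "y i = (case i of 0 \<Rightarrow> a | Suc i \<Rightarrow> x i)" for i
      have "skew ?f (y i) (y (Suc i))" if "i < Suc k" for i
        using that x b by (cases i) (auto simp: y_def)
      then show ?thesis using x(2) by (intro disjI2 exI[of _ y]) (simp add: y_def)
    qed
  next
    case False
    show ?thesis
    proof (cases "a < length P")
      case True
      then obtain q where q: "isometric_path G q" "rooted v q" "\<And>i. a \<le> i \<Longrightarrow> i \<le> length P - 1 \<Longrightarrow> P ! i \<in> set q"
      proof -
        have "a \<le> length P - 1" "length P - 1 < length P" using True by auto
        then show thesis using seg[of "length P - 1"] False that by blast
      qed
      then show ?thesis
        unfolding rooted_coverable_def by (intro disjI1 exI[of _ "{q}"]) (simp, auto)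
    next
      case False
      then have "{P ! i | i. a \<le> i \<and> i < length P} = {}" by auto
      then show ?thesis unfolding rooted_coverable_def by (intro disjI1 exI[of _ "{}"]) simp
    qed
  qed
qed

text \<open>By minimality of \<open>ipco G\<close>, a smaller \<open>k\<close> fails at every root;
  so the uncovered path exists for whichever \<open>v\<close> is prescribed.\<close>

lemma skew_sequence_if_less_ipco:
  assumes "k < ipco G" "v \<in> verts G"
  obtains P x where "isometric_path G P" "x k < length P" "\<And>i. i < k \<Longrightarrow> skew (\<lambda>i. d v (P ! i)) (x i) (x (Suc i))"
proof -
  have "\<not> (\<exists>v\<in>verts G. \<forall>P. isometric_path G P \<longrightarrow> rooted_coverable G v k (set P))"
    using assms(1) unfolding ipco_def by (rule not_less_Least)
  then obtain P where P: "isometric_path G P" "\<not> rooted_coverable G v k (set P)" using assms(2) by blast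
  have "set P = {P ! i | i. 0 \<le> i \<and> i < length P}" by (auto simp: in_set_conv_nth)
  then show thesis
    using coverable_or_skew_sequence[OF P(1) assms(2), of k 0] P that by auto
qed

text \<open>A strict inequality between naturals gains at least 1, so \<open>j - i\<close> skew
  steps gain at least \<open>j - i\<close>.\<close>

lemma skew_sequence_mono:
  assumes "\<And>i. i < k \<Longrightarrow> skew f (x i) (x (Suc i))" "i \<le> j" "j \<le> k"
  shows "f (x i) + x i + (j - i) \<le> f (x j) + x j" "f (x j) + x i + (j - i) \<le> f (x i) + x j" "x i + (j - i) \<le> x j"
  using assms(2,3)
proof (induction j rule: dec_induct)
  case (step j)
  {
    case 1
    then show ?case using step assms(1)[of j] by (auto simp: skew_def)
  next
    case 2
    then show ?case using step assms(1)[of j] by (auto simp: skew_def)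
  next
    case 3
    then show ?case using step assms(1)[of j] by (auto simp: skew_def)
  }
qed simp_all

section \<open>Hyperbolic graphs\<close>

text \<open>Over \<open>2 * K\<close> skew steps, the sum that pairs the two outer points with each
  other and the middle one with \<open>v\<close> exceeds both other sums by at least
  \<open>K\<close>, and \<open>K\<close> is chosen above \<open>2 * \<delta>\<close>.\<close>

lemma ipco_le_if_hyperbolic:
  fixes \<delta> :: real
  assumes "hyperbolic \<delta> G"
  shows "real (ipco G) \<le> 4 * \<delta> + 3"
proof (rule ccontr)
  assume *: "\<not> real (ipco G) \<le> 4 * \<delta> + 3"
  obtain v where v: "v \<in> verts G" using connected by (auto simp: connected_def strongly_connected_def)
  have hyp: "real (sort [d a b + d x y, d a x + d b y, d a y + d b x] ! 2) -
      real (sort [d a b + d x y, d a x + d b y, d a y + d b x] ! 1) \<le> 2 * \<delta>"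
    if "a \<in> verts G" "b \<in> verts G" "x \<in> verts G" "y \<in> verts G" for a b x y
    using assms that unfolding hyperbolic_def Let_def by simp
  \<comment> \<open>Four equal vertices make all three sums 0.\<close>
  have "0 \<le> \<delta>" using hyp[OF v v v v] by (simp add: d_self v)
  \<comment> \<open>The least natural number above \<open>2 * \<delta>\<close>; then
    \<open>2 * K\<close> is at most \<open>4 * \<delta> + 2\<close>, which is below the assumed
    \<open>ipco G\<close>.\<close>
  define K where "K = Suc (nat \<lfloor>2 * \<delta>\<rfloor>)"
  have K: "2 * \<delta> < K" "K \<le> 2 * \<delta> + 1" using \<open>0 \<le> \<delta>\<close> unfolding K_def by linarith+
  have "real (2 * K) < ipco G" using * K by simp
  then have "2 * K < ipco G" by linarith
  then obtain P x where P: "isometric_path G P" "x (2 * K) < length P"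
    "\<And>i. i < 2 * K \<Longrightarrow> skew (\<lambda>i. d v (P ! i)) (x i) (x (Suc i))"
    by (rule skew_sequence_if_less_ipco[OF _ v]) blast
  let ?f = "\<lambda>i. d v (P ! i)"
  have 1: "?f (x 0) + x 0 + K \<le> ?f (x K) + x K" "x 0 + K \<le> x K"
    using skew_sequence_mono[of "2 * K" ?f x 0 K, OF P(3)] by auto
  have 2: "?f (x (2 * K)) + x K + K \<le> ?f (x K) + x (2 * K)" "x K + K \<le> x (2 * K)"
    using skew_sequence_mono[of "2 * K" ?f x K "2 * K", OF P(3)] by auto
  let ?l = "P ! x 0" and ?c = "P ! x K" and ?r = "P ! x (2 * K)"
  have V: "?l \<in> verts G" "?c \<in> verts G" "?r \<in> verts G"
    using isometric_pathD(4)[OF P(1)] P(2) 1 2 by auto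
  have D: "d ?l ?r = x (2 * K) - x 0" "d ?l ?c = x K - x 0" "d ?c ?r = x (2 * K) - x K"
    using 1 2 P(2) by (auto intro!: isometric_nth[OF P(1)])
  let ?s1 = "d ?l ?r + d v ?c" and ?s2 = "d ?l v + d ?r ?c" and ?s3 = "d ?l ?c + d ?r v"
  \<comment> \<open>The excess over \<open>?s2\<close> is the growth of \<open>?f i + i\<close> up
    to the middle point; the excess over \<open>?s3\<close> is the decrease of
    \<open>?f i - i\<close> after it.\<close>
  have gap: "?s2 + K \<le> ?s1" "?s3 + K \<le> ?s1"
    using 1 2 D d_sym[of ?l v] d_sym[of ?r ?c] d_sym[of ?r v] V v by auto
  have "real (sort [?s1, ?s2, ?s3] ! 2) - real (sort [?s1, ?s2, ?s3] ! 1) \<le> 2 * \<delta>"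
    by (rule hyp[OF V(1,3) v V(2)])
  moreover have "real K \<le> real (sort [?s1, ?s2, ?s3] ! 2) - real (sort [?s1, ?s2, ?s3] ! 1)"
    using gap by (auto simp: K_def)
  ultimately show False using K by linarith
qed

section \<open>Graphs of large isometric path complexity\<close>

lemma adj_isometric_nth:
  assumes P: "isometric_path G P" and ij: "i < length P" "j < length P"
  shows "adj G (P ! i) (P ! j) \<longleftrightarrow> j = Suc i \<or> i = Suc j"
proof -
  have *: "adj G (P ! a) (P ! b) \<longleftrightarrow> b = Suc a" if "a \<le> b" "b < length P" for a b
  proof
    assume "adj G (P ! a) (P ! b)"
    moreover have "\<not> adj G (P ! a) (P ! a)" using adj_irreflp[of G] by (auto simp: irreflp_def graph_axioms)
    ultimately have "a \<noteq> b" "b - a \<le> 1" using d_adj isometric_nth[OF P that] by force+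
    then show "b = Suc a" using that by simp
  next
    assume "b = Suc a"
    then show "adj G (P ! a) (P ! b)"
      using isometric_pathD(1)[OF P] that successively_nth[of "adj G" P a] by (simp add: vwalk_iff_successively)
  qed
  show ?thesis
  proof (cases "i \<le> j")
    case True
    then show ?thesis using *[OF True ij(2)] by auto
  next
    case False
    then show ?thesis using *[of j i] ij adj_sym[of "P ! i"] by auto
  qed
qed

lemma ipath_segment:
  assumes P: "isometric_path G P" and n: "n \<le> length P"
  shows "ipath (adj G) (map ((!) P) [m..<n])"
proof -
  have "i = j" if "i < n" "j < n" "P ! i = P ! j" for i j
    using isometric_pathD(2)[OF P] that n by (simp add: nth_eq_iff_index_eq)
  then have "distinct (map ((!) P) [m..<n])" by (auto simp: distinct_map intro!: inj_onI)
  then show ?thesis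
    using adj_isometric_nth[OF P] n
    by (subst ipath_nth[OF adj_symp adj_irreflp]) (auto simp: graph_axioms)
qed

text \<open>A geodesic from \<open>u\<close> to \<open>v\<close> is cut at its last vertex that lies
  in \<open>B\<close> or has a neighbour there. What remains still consists of vertices on a
  geodesic, and only its first vertex touches \<open>B\<close>.\<close>

lemma trimmed_geodesic:
  assumes "u \<in> verts G" "v \<in> verts G" "u \<in> B" "\<not> (v \<in> B \<or> (\<exists>b\<in>B. adj G v b))"
  obtains Q where "Q \<noteq> []" "successively (adj G) Q" "last Q = v"
    "\<And>z. z \<in> set Q \<Longrightarrow> z \<in> verts G \<and> d v u = d v z + d z u"
    "hd Q \<notin> B" "\<exists>b\<in>B. adj G (hd Q) b" "\<And>z. z \<in> set (tl Q) \<Longrightarrow> z \<notin> B \<and> (\<forall>b\<in>B. \<not> adj G z b)"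
proof -
  obtain R where R: "isometric_path G R" "hd R = u" "last R = v"
    by (rule isometric_path_exists[OF assms(1,2)])
  note RD = isometric_pathD[OF R(1)]
  have geo: "z \<in> verts G \<and> d v u = d v z + d z u" if "z \<in> set R" for z
  proof -
    obtain i where i: "i < length R" "z = R ! i" using \<open>z \<in> set R\<close> by (auto simp: in_set_conv_nth)
    have e: "u = R ! 0" "v = R ! (length R - 1)" using R RD(3) by (simp_all add: hd_conv_nth last_conv_nth)
    have "d u v = length R - 1" "d u z = i" "d z v = length R - 1 - i"
      unfolding e i(2) using i(1) by (auto intro!: isometric_nth[OF R(1), THEN trans])
    moreover have "z \<in> verts G" using RD(4) that by auto
    ultimately show ?thesis using i(1) d_sym[OF assms(1,2)] d_sym[of z v] d_sym[of z u] assms(1,2) by simp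
  qed
  let ?C = "\<lambda>z. z \<in> B \<or> (\<exists>b\<in>B. adj G z b)"
  have "\<exists>z\<in>set R. ?C z" using assms(3) R(2) hd_in_set[OF RD(3)] by blast
  then obtain R1 a R2 where R12: "R = R1 @ a # R2" "?C a" "\<forall>z\<in>set R2. \<not> ?C z"
    using split_list_last_prop[of R ?C] by blast
  have succ: "successively (adj G) (a # R2)" "last (a # R2) = v"
    using RD(1) R(3) by (simp_all add: R12(1) vwalk_iff_successively successively_append_iff)
  \<comment> \<open>Otherwise the next vertex, which exists because \<open>v\<close> is not in
    \<open>B\<close>, would be a later contact.\<close>
  have "a \<notin> B"
  proof
    assume a: "a \<in> B"
    then have "R2 \<noteq> []" using succ(2) assms(4) by auto
    then have "adj G (hd R2) a" "hd R2 \<in> set R2"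
      using succ(1) adj_sym[of a "hd R2"] by (simp_all add: successively_Cons)
    then show False using R12(3) a by blast
  qed
  show thesis
  proof (rule that[of "a # R2"])
    show "z \<in> verts G \<and> d v u = d v z + d z u" if "z \<in> set (a # R2)" for z
      by (rule geo) (use that R12(1) in auto)
    show "\<exists>b\<in>B. adj G (hd (a # R2)) b" using R12(2) \<open>a \<notin> B\<close> by simp
    show "z \<notin> B \<and> (\<forall>b\<in>B. \<not> adj G z b)" if "z \<in> set (tl (a # R2))" for z
      using R12(3) that by simp
  qed (use succ \<open>a \<notin> B\<close> in simp_all)
qed

text \<open>The route to \<open>P ! j\<close> through \<open>z\<close> replaces
  \<open>d z (P ! c)\<close>, which is at least the index difference of \<open>c\<close> and
  \<open>j\<close> minus \<open>d z (P ! j)\<close>, by \<open>d z (P ! j)\<close>. Along a skew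
  sequence this keeps \<open>j\<close> near \<open>c\<close> whenever \<open>z\<close> is near
  \<open>P ! j\<close>.\<close>

lemma geodesic_far:
  assumes P: "isometric_path G P" and v: "v \<in> verts G" and z: "z \<in> verts G"
    and geo: "d v (P ! c) = d v z + d z (P ! c)" and cj: "c < length P" "j < length P"
  shows "d v (P ! j) + j \<le> d v (P ! c) + c + 2 * d z (P ! j)" "d v (P ! j) + c \<le> d v (P ! c) + j + 2 * d z (P ! j)"
proof -
  have V: "P ! c \<in> verts G" "P ! j \<in> verts G" using isometric_pathD(4)[OF P] cj by auto
  have "d (P ! c) (P ! j) \<ge> j - c" "d (P ! c) (P ! j) \<ge> c - j"
    using isometric_nth[OF P, of c j] isometric_nth[OF P, of j c] cj d_sym[OF V] by (cases "c \<le> j"; force)+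
  moreover have "d (P ! c) (P ! j) \<le> d z (P ! c) + d z (P ! j)" "d v (P ! j) \<le> d v z + d z (P ! j)"
    using d_triangle[OF V(1) z V(2)] d_triangle[OF v z V(2)] d_sym[OF z V(1)] by simp_all
  ultimately show "d v (P ! j) + j \<le> d v (P ! c) + c + 2 * d z (P ! j)" "d v (P ! j) + c \<le> d v (P ! c) + j + 2 * d z (P ! j)"
    using geo by linarith+
qed

text \<open>The three legs \<open>Q1\<close>, \<open>Q2\<close>, \<open>Q3\<close> are geodesics to the root, cut off at their last contact with the
  path. A shortest connection of the outer two within their union closes the segment of \<open>P\<close> between them to
  an induced cycle; a shortest connection from the middle leg to it is the path across.\<close>

lemma web_if_three_legs:
  assumes P: "isometric_path G P" and r: "r < length P"
    and B_def: "B = (!) P ` {l..r}"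
    and Q: "\<And>Q. Q \<in> {Q1, Q2, Q3} \<Longrightarrow> Q \<noteq> [] \<and> successively (adj G) Q \<and> last Q = v \<and> set Q \<subseteq> verts G"
    and attach: "\<And>Q. Q \<in> {Q1, Q2, Q3} \<Longrightarrow> hd Q \<notin> B \<and> (\<exists>b\<in>B. adj G (hd Q) b)"
    and free: "\<And>Q z. Q \<in> {Q1, Q2, Q3} \<Longrightarrow> z \<in> set (tl Q) \<Longrightarrow> z \<notin> B \<and> (\<forall>b\<in>B. \<not> adj G z b)"
    and zone: "\<And>j. j \<in> {l..r} \<Longrightarrow> adj G (hd Q1) (P ! j) \<Longrightarrow> j < p1"
      "\<And>j. j \<in> {l..r} \<Longrightarrow> adj G (hd Q2) (P ! j) \<Longrightarrow> p2 \<le> j \<and> j < p3"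
      "\<And>j. j \<in> {l..r} \<Longrightarrow> adj G (hd Q3) (P ! j) \<Longrightarrow> p4 < j"
    and gaps: "p1 + 4 \<le> p2" "p2 \<le> p3" "p3 + 4 \<le> p4"
    and far: "\<And>w. w \<in> set Q1 \<union> set Q3 \<Longrightarrow> 6 \<le> d (hd Q2) w"
  shows "\<exists>H A C D H'. web (adj G) H A C D H' \<and> set (H @ A @ C @ D @ H') \<subseteq> verts G"
proof -
  have E: "symp (adj G)" "irreflp (adj G)" using adj_symp[of G] adj_irreflp[of G] graph_axioms by auto
  define K where "K = set Q1 \<union> set Q3"
  have KV: "K \<subseteq> verts G" using Q by (auto simp: K_def)
  have contact: "z = hd Q1 \<or> z = hd Q2 \<or> z = hd Q3"
    if z: "z \<in> set Q1 \<union> set Q2 \<union> set Q3" "z \<in> B \<or> (\<exists>b\<in>B. adj G z b)" for z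
  proof -
    obtain Q where "Q \<in> {Q1, Q2, Q3}" "z \<in> set Q" using z(1) by auto
    then have "z = hd Q" using free[of Q z] z(2) by (cases Q) auto
    then show ?thesis using \<open>Q \<in> {Q1, Q2, Q3}\<close> by auto
  qed
  obtain j1 where j1: "j1 \<in> {l..r}" "adj G (hd Q1) (P ! j1)" using attach[of Q1] by (auto simp: B_def)
  obtain j2 where j2: "j2 \<in> {l..r}" "adj G (hd Q2) (P ! j2)" using attach[of Q2] by (auto simp: B_def)
  obtain j3 where j3: "j3 \<in> {l..r}" "adj G (hd Q3) (P ! j3)" using attach[of Q3] by (auto simp: B_def)
  have ne: "hd Q1 \<noteq> hd Q3" using zone(1)[OF j1] zone(3)[OF j1(1)] j1(2) gaps by fastforce
  have far': "hd Q2 \<notin> K" using far d_self[of "hd Q2"] KV by (force simp: K_def)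

  have vw: "vwalk Q G" if "Q \<in> {Q1, Q2, Q3}" for Q using Q[OF that] by (simp add: vwalk_iff_successively)
  have QN: "Q1 \<noteq> []" "Q2 \<noteq> []" "Q3 \<noteq> []" "last Q1 = v" "last Q2 = v" "last Q3 = v" using Q by auto
  have tl_rev: "set (tl (rev p)) \<subseteq> set p" for p :: "'a list" using list.set_sel(2)[of "rev p"] by (cases "rev p") auto
  \<comment> \<open>Through the common end \<open>v\<close>: along the first leg and back along the
    third.\<close>
  let ?w = "Q1 @ tl (rev Q3)"
  have w: "vwalk ?w G" "hd ?w = hd Q1" "last ?w = hd Q3"
    using vwalk_join[of Q1 G "rev Q3"] vw QN by (simp_all add: vwalk_rev hd_rev last_rev)
  obtain W where W: "ipath (adj G) W" "W \<noteq> []" "set W \<subseteq> K" "hd W = hd ?w" "last W \<in> {hd Q3}"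
    by (rule shortest_ipath[OF E(1), of ?w K "{hd Q3}"])
      (use w tl_rev[of Q3] in \<open>auto simp: vwalk_iff_successively K_def\<close>)
  then have W: "ipath (adj G) W" "W \<noteq> []" "set W \<subseteq> K" "hd W = hd Q1" "last W = hd Q3" using w by simp_all
  have W2: "hd W \<noteq> last W" using W(4,5) ne by simp
  \<comment> \<open>The two ends of \<open>W\<close> differ, so no vertex of \<open>W\<close> is
    isolated on it. This places \<open>W\<close> inside the set \<open>T\<close> used below.\<close>
  have W_nb: "\<exists>w'\<in>set W. adj G w w'" if w: "w \<in> set W" for w
  proof (cases "w = last W")
    case True
    obtain W' y where y: "W = W' @ [y]" using W(2) by (cases W rule: rev_cases) auto
    then have "W' \<noteq> []" using W2 by auto
    then have "adj G y (last W')" "last W' \<in> set W"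
      using ipath_successively[OF W(1)] adj_sym[of y "last W'"] by (simp_all add: y successively_append_iff)
    then show ?thesis using True y by auto
  next
    case False
    obtain us vs where uv: "W = us @ w # vs" using w by (auto simp: in_set_conv_decomp)
    then have "vs \<noteq> []" using False by auto
    then have "adj G w (hd vs)" "hd vs \<in> set W"
      using ipath_successively[OF W(1)] by (auto simp: uv successively_append_iff successively_Cons)
    then show ?thesis by blast
  qed

  \<comment> \<open>The last contact of \<open>hd Q1\<close> and the first contact of
    \<open>hd Q3\<close>: the segment \<open>R\<close> between them is adjacent to \<open>W\<close>
    only at its ends.\<close>
  define i where "i = Max {j \<in> {l..r}. adj G (hd Q1) (P ! j)}"
  define k where "k = Min {j \<in> {l..r}. adj G (hd Q3) (P ! j)}"
  have i: "i \<in> {l..r}" "adj G (hd Q1) (P ! i)" "\<And>j. j \<in> {l..r} \<Longrightarrow> adj G (hd Q1) (P ! j) \<Longrightarrow> j \<le> i"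
  proof -
    have fin: "finite {j \<in> {l..r}. adj G (hd Q1) (P ! j)}" by simp
    have "i \<in> {j \<in> {l..r}. adj G (hd Q1) (P ! j)}" unfolding i_def using j1 by (intro Max_in fin) auto
    then show "i \<in> {l..r}" "adj G (hd Q1) (P ! i)" by auto
    show "j \<le> i" if "j \<in> {l..r}" "adj G (hd Q1) (P ! j)" for j
      unfolding i_def using that by (intro Max_ge fin) simp
  qed
  have k: "k \<in> {l..r}" "adj G (hd Q3) (P ! k)" "\<And>j. j \<in> {l..r} \<Longrightarrow> adj G (hd Q3) (P ! j) \<Longrightarrow> k \<le> j"
  proof -
    have fin: "finite {j \<in> {l..r}. adj G (hd Q3) (P ! j)}" by simp
    have "k \<in> {j \<in> {l..r}. adj G (hd Q3) (P ! j)}" unfolding k_def using j3 by (intro Min_in fin) auto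
    then show "k \<in> {l..r}" "adj G (hd Q3) (P ! k)" by auto
    show "k \<le> j" if "j \<in> {l..r}" "adj G (hd Q3) (P ! j)" for j
      unfolding k_def using that by (intro Min_le fin) simp
  qed
  have ik: "i < p1" "p4 < k" using zone i k by auto
  define R where "R = map ((!) P) [i..<Suc k]"
  have R: "ipath (adj G) R" unfolding R_def by (rule ipath_segment[OF P]) (use k r in auto)
  have R_set: "\<exists>j\<in>{i..k}. z = P ! j" if "z \<in> set R" for z using that by (auto simp: R_def)
  have RB: "set R \<subseteq> B" using i(1) k(1) by (auto simp: R_def B_def)
  have Rends: "R \<noteq> []" "hd R = P ! i" "last R = P ! k"
    using ik gaps by (auto simp: R_def hd_map last_map)
  \<comment> \<open>Contacts of \<open>hd Q2\<close> on \<open>R\<close> all lie in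
    \<open>S2\<close>; the gaps give \<open>S1\<close> and \<open>S3\<close> at least four
    vertices.\<close>
  define S1 where "S1 = map ((!) P) [i..<p2]"
  define S2 where "S2 = map ((!) P) [p2..<p3]"
  define S3 where "S3 = map ((!) P) [p3..<Suc k]"
  have "[i..<Suc k] = [i..<p2] @ [p2..<p3] @ [p3..<Suc k]"
    using upt_add_eq_append[of i p2 "Suc k - p2"] upt_add_eq_append[of p2 p3 "Suc k - p3"] ik gaps by simp
  then have S: "R = S1 @ S2 @ S3" unfolding R_def S1_def S2_def S3_def by (simp only: map_append)
  have S_len: "4 \<le> length S1" "4 \<le> length S3" using ik gaps by (simp_all add: S1_def S3_def)
  have S_free: "\<forall>z\<in>set S1 \<union> set S3. \<not> adj G (hd Q2) z"
  proof
    fix z assume "z \<in> set S1 \<union> set S3"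
    then obtain j where "z = P ! j" "i \<le> j \<and> j < p2 \<or> p3 \<le> j \<and> j \<le> k" by (auto simp: S1_def S3_def)
    then show "\<not> adj G (hd Q2) z" using zone(2)[of j] ik gaps i(1) k(1) by auto
  qed

  \<comment> \<open>Aiming at the vertices with a neighbour on \<open>W\<close>, instead of at
    \<open>W\<close>, makes \<open>last X\<close> the only vertex of \<open>X\<close> adjacent to
    \<open>W\<close>.\<close>
  define T where "T = {y. \<exists>w\<in>set W. adj G y w}"
  let ?x = "Q2 @ tl (rev Q1)"
  have "vwalk ?x G" "hd ?x = hd Q2" "last ?x = hd Q1"
    using vwalk_join[of Q2 G "rev Q1"] vw QN by (simp_all add: vwalk_rev hd_rev last_rev)
  moreover have "hd Q1 \<in> T" using W_nb[OF hd_in_set[OF W(2)]] unfolding W(4) by (simp add: T_def)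
  ultimately have x: "vwalk ?x G" "hd ?x = hd Q2" "last ?x \<in> T" by simp_all
  obtain X where X: "ipath (adj G) X" "X \<noteq> []" "set X \<subseteq> set Q1 \<union> set Q2 \<union> set Q3" "hd X = hd ?x"
    "last X \<in> T" "set (butlast X) \<inter> T = {}"
    by (rule shortest_ipath[OF E(1), of ?x "set Q1 \<union> set Q2 \<union> set Q3" T])
      (use x tl_rev[of Q1] in \<open>auto simp: vwalk_iff_successively\<close>)
  note X = X[unfolded x(2)]
  \<comment> \<open>\<open>hd X\<close> has distance at least 6 from \<open>W\<close>, and
    \<open>last X\<close> has a neighbour on \<open>W\<close>; so \<open>X\<close> has at least 5
    edges.\<close>
  have X_len: "6 \<le> length X"
  proof -
    obtain w where w: "w \<in> set W" "adj G (last X) w" using X(5) by (auto simp: T_def)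
    have XV: "set X \<subseteq> verts G" using X(3) Q by blast
    then have "vwalk X G" using X(2) ipath_successively[OF X(1)] by (simp add: vwalk_iff_successively)
    then have "d (hd Q2) (last X) \<le> length X - 1" using gdist_le_vwalk[of X G] X(4) by simp
    moreover have "hd X \<in> verts G" "last X \<in> verts G" "w \<in> verts G"
      using XV hd_in_set[OF X(2)] last_in_set[OF X(2)] adj_verts[OF w(2)] by auto
    then have "d (hd Q2) w \<le> d (hd Q2) (last X) + d (last X) w" using X(4) by (intro d_triangle) auto
    moreover have "6 \<le> d (hd Q2) w" using far w(1) W(3) by (auto simp: K_def)
    ultimately show ?thesis using d_adj[OF w(2)] by linarith
  qed
  have XT: "x = last X" if "x \<in> set X" "x \<in> T" for x
  proof -
    have "x \<in> set (butlast X) \<or> x = last X"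
      using that(1) X(2) by (metis append_butlast_last_id in_set_conv_decomp rotate1.simps(2) set_ConsD set_rotate1)
    then show ?thesis using X(6) that(2) by blast
  qed
  \<comment> \<open>A common vertex lies in \<open>T\<close>, so it is \<open>last X\<close>; then
    its predecessor on \<open>X\<close> is adjacent to \<open>W\<close> too and would also have to
    be \<open>last X\<close>.\<close>
  have XW: "set W \<inter> set X = {}"
  proof (rule ccontr)
    assume "set W \<inter> set X \<noteq> {}"
    then obtain w where w: "w \<in> set W" "w \<in> set X" by blast
    then have "w = last X" using XT[of w] W_nb[OF w(1)] by (simp add: T_def)
    moreover obtain X' y z where Xy: "X = X' @ [y, z]"
      using X_len by (cases X rule: rev_cases; cases "butlast X" rule: rev_cases) auto
    ultimately have "adj G y w" using ipath_successively[OF X(1)] by (simp add: successively_append_iff)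
    then have "y = last X" using XT[of y] w(1) Xy by (auto simp: T_def)
    then show False using ipath_distinct[OF X(1)] Xy by simp
  qed
  \<comment> \<open>Contacts with the path are heads of legs; those of \<open>Q1\<close> and
    \<open>Q3\<close> lie on \<open>W\<close>, which leaves \<open>hd Q2 = hd X\<close>.\<close>
  have X_contact: "x = hd X" if "x \<in> set X" "x \<in> B \<or> (\<exists>b\<in>B. adj G x b)" for x
  proof -
    have "x = hd Q1 \<or> x = hd Q2 \<or> x = hd Q3" using contact[of x] that X(3) by blast
    moreover have "hd Q1 \<in> set W" "hd Q3 \<in> set W" using W(2,4,5) hd_in_set[of W] last_in_set[of W] by auto
    ultimately show ?thesis using XW that(1) X(4) by auto
  qed
  have headB: "hd Q1 \<notin> B" "hd Q2 \<notin> B" "hd Q3 \<notin> B" using attach by simp_all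
  have "\<exists>H A C D H'. web (adj G) H A C D H' \<and> set (H @ A @ C @ D @ H') \<subseteq> set R \<union> set W \<union> set X"
  proof (rule turtle_imp_web[OF E R W(1) X(1) X_len _ _ XW _ _ _ _ _ S _ S_len])
    have "z \<notin> B" if "z \<in> set Q1 \<union> set Q2 \<union> set Q3" for z
      using contact[OF that] headB by metis
    then show "set R \<inter> set W = {}" "set R \<inter> set X = {}" using RB W(3) X(3) by (auto simp: K_def)
    show "\<forall>p\<in>set R. \<forall>w\<in>set W. adj G p w \<longleftrightarrow> p = hd R \<and> w = hd W \<or> p = last R \<and> w = last W"
    proof (intro ballI)
      fix p w assume p: "p \<in> set R" and w: "w \<in> set W"
      obtain j where j: "j \<in> {i..k}" "p = P ! j" using R_set[OF p] by blast
      have jlr: "j \<in> {l..r}" using j(1) i(1) k(1) by simp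
      show "adj G p w \<longleftrightarrow> p = hd R \<and> w = hd W \<or> p = last R \<and> w = last W"
      proof
        assume "adj G p w"
        then have wp: "adj G w p" by (simp add: adj_sym)
        then have "w = hd Q1 \<or> w = hd Q2 \<or> w = hd Q3"
          using contact[of w] w W(3) p RB by (auto simp: K_def)
        moreover have "w \<noteq> hd Q2" using w W(3) far' by auto
        ultimately show "p = hd R \<and> w = hd W \<or> p = last R \<and> w = last W"
        proof (elim disjE)
          assume "w = hd Q1"
          then have "j = i" using i(3)[OF jlr] wp j by simp
          then show ?thesis using j(2) Rends W(4) \<open>w = hd Q1\<close> by simp
        next
          assume "w = hd Q3"
          then have "j = k" using k(3)[OF jlr] wp j by simp
          then show ?thesis using j(2) Rends W(5) \<open>w = hd Q3\<close> by simp
        qed simp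
      next
        assume "p = hd R \<and> w = hd W \<or> p = last R \<and> w = last W"
        then show "adj G p w"
          using i(2) k(2) W(4,5) Rends adj_sym[of p w] by auto
      qed
    qed
    show "\<forall>x\<in>set X. \<forall>p\<in>set R. adj G x p \<longrightarrow> x = hd X" using X_contact RB by blast
    show "\<exists>p\<in>set R. adj G (hd X) p"
    proof -
      have "j2 \<in> {i..k}" using zone(2)[OF j2] ik gaps by simp
      then have "P ! j2 \<in> set R" unfolding R_def set_map set_upt by (intro imageI) simp
      then show ?thesis using j2(2) X(4) by auto
    qed
    show "\<forall>x\<in>set X. \<forall>w\<in>set W. adj G x w \<longrightarrow> x = last X"
      using XT by (auto simp: T_def)
    show "\<exists>w\<in>set W. adj G (last X) w" using X(5) by (simp add: T_def)
    show "\<forall>z\<in>set S1 \<union> set S3. \<not> adj G (hd X) z" using S_free X(4) by simp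
  qed
  moreover have "set R \<union> set W \<union> set X \<subseteq> verts G"
  proof -
    have "set R \<subseteq> verts G" using isometric_pathD(4)[OF P] r k(1) by (auto simp: R_def)
    then show ?thesis using W(3) KV X(3) Q by blast
  qed
  ultimately show ?thesis by (meson order_trans)
qed

text \<open>The constants: a contact costs at most 2 in \<open>geodesic_far\<close>, so three skew
  steps confine the contacts of the leg from \<open>x m\<close> to indices between
  \<open>x (m - 3)\<close> and \<open>x (m + 3)\<close>. With legs at 0, 20 and 40, the middle zone
  is 17 steps from the index of either outer leg.\<close>

lemma web_if_skew_sequence:
  assumes P: "isometric_path G P" and v: "v \<in> verts G" and len: "x 40 < length P"
    and skew: "\<And>i. i < 40 \<Longrightarrow> skew (\<lambda>i. d v (P ! i)) (x i) (x (Suc i))"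
  shows "\<exists>H A B C H'. web (adj G) H A B C H' \<and> set (H @ A @ B @ C @ H') \<subseteq> verts G"
proof -
  let ?f = "\<lambda>i. d v (P ! i)"
  note mono = skew_sequence_mono[of 40 ?f x, OF skew]
  have xlen: "x i < length P" if "i \<le> 40" for i using mono(3)[of i 40] that len by auto
  have VP: "P ! i \<in> verts G" if "i < length P" for i using isometric_pathD(4)[OF P] that by auto
  define B where "B = (!) P ` {x 0..x 40}"
  have B_less: "i < length P" if "i \<in> {x 0..x 40}" for i using that len by auto
  have zoneR: "j < x (m + 3)"
    if z: "z \<in> verts G" "?f (x m) = d v z + d z (P ! x m)" "d z (P ! j) \<le> 1" and m: "m \<le> 37" "j < length P" for m z j
  proof (rule ccontr)
    assume "\<not> j < x (m + 3)"
    then have "?f (x (m + 3)) + x (m + 3) \<le> ?f j + j" using lipschitz(1)[OF P v] m by simp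
    moreover have "?f j + j \<le> ?f (x m) + x m + 2"
      using geodesic_far(1)[OF P v z(1,2) xlen m(2)] z(3) m by linarith
    ultimately show False using mono(1)[of m "m + 3"] m by simp
  qed
  have zoneL: "x (m - 3) < j"
    if z: "z \<in> verts G" "?f (x m) = d v z + d z (P ! x m)" "d z (P ! j) \<le> 1" and m: "3 \<le> m" "m \<le> 40" "j < length P" for m z j
  proof (rule ccontr)
    assume "\<not> x (m - 3) < j"
    then have "?f (x (m - 3)) + j \<le> ?f j + x (m - 3)" using lipschitz(2)[OF P v, of j "x (m - 3)"] xlen[of "m - 3"] m by simp
    moreover have "?f j + x m \<le> ?f (x m) + j + 2"
      using geodesic_far(2)[OF P v z(1,2) xlen m(3)] z(3) m by linarith
    ultimately show False using mono(2)[of "m - 3" m] m by simp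
  qed
  have x_in: "x i \<in> {x 0..x 40}" if "i \<le> 40" for i using mono(3)[of 0 i] mono(3)[of i 40] that by auto
  \<comment> \<open>The root lies on the geodesics from both ends, so a contact of it with the path
    would fall into both end zones.\<close>
  have v_far: "\<not> (v \<in> B \<or> (\<exists>b\<in>B. adj G v b))"
  proof
    assume "v \<in> B \<or> (\<exists>b\<in>B. adj G v b)"
    then obtain j where j: "j \<in> {x 0..x 40}" "d v (P ! j) \<le> 1" using d_adj d_self v by (force simp: B_def)
    then have "j < x 3" "x 37 < j"
      using zoneR[OF v _ j(2), of 0] zoneL[OF v _ j(2), of 40] d_self[OF v] B_less[OF j(1)] by simp_all
    then show False using mono(3)[of 3 37] by simp
  qed
  have leg: "\<exists>Q. Q \<noteq> [] \<and> successively (adj G) Q \<and> last Q = v \<and>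
    (\<forall>z\<in>set Q. z \<in> verts G \<and> ?f (x m) = d v z + d z (P ! x m)) \<and>
    hd Q \<notin> B \<and> (\<exists>b\<in>B. adj G (hd Q) b) \<and> (\<forall>z\<in>set (tl Q). z \<notin> B \<and> (\<forall>b\<in>B. \<not> adj G z b))"
    if "m \<le> 40" for m
  proof -
    have "P ! x m \<in> verts G" "P ! x m \<in> B" using VP xlen[OF that] x_in[OF that] by (auto simp: B_def)
    then show ?thesis using trimmed_geodesic[OF _ v _ v_far, of "P ! x m"] by metis
  qed
  obtain Q1 where Q1: "Q1 \<noteq> []" "successively (adj G) Q1" "last Q1 = v"
    "\<forall>z\<in>set Q1. z \<in> verts G \<and> ?f (x 0) = d v z + d z (P ! x 0)"
    "hd Q1 \<notin> B" "\<exists>b\<in>B. adj G (hd Q1) b" "\<forall>z\<in>set (tl Q1). z \<notin> B \<and> (\<forall>b\<in>B. \<not> adj G z b)"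
    using leg[of 0] by auto
  obtain Q2 where Q2: "Q2 \<noteq> []" "successively (adj G) Q2" "last Q2 = v"
    "\<forall>z\<in>set Q2. z \<in> verts G \<and> ?f (x 20) = d v z + d z (P ! x 20)"
    "hd Q2 \<notin> B" "\<exists>b\<in>B. adj G (hd Q2) b" "\<forall>z\<in>set (tl Q2). z \<notin> B \<and> (\<forall>b\<in>B. \<not> adj G z b)"
    using leg[of 20] by auto
  obtain Q3 where Q3: "Q3 \<noteq> []" "successively (adj G) Q3" "last Q3 = v"
    "\<forall>z\<in>set Q3. z \<in> verts G \<and> ?f (x 40) = d v z + d z (P ! x 40)"
    "hd Q3 \<notin> B" "\<exists>b\<in>B. adj G (hd Q3) b" "\<forall>z\<in>set (tl Q3). z \<notin> B \<and> (\<forall>b\<in>B. \<not> adj G z b)"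
    using leg[of 40] by auto
  have hds: "hd Q1 \<in> set Q1" "hd Q2 \<in> set Q2" "hd Q3 \<in> set Q3" using Q1(1) Q2(1) Q3(1) by auto
  have h1: "hd Q1 \<in> verts G" "?f (x 0) = d v (hd Q1) + d (hd Q1) (P ! x 0)" using Q1(4) hds(1) by blast+
  have h2: "hd Q2 \<in> verts G" "?f (x 20) = d v (hd Q2) + d (hd Q2) (P ! x 20)" using Q2(4) hds(2) by blast+
  have h3: "hd Q3 \<in> verts G" "?f (x 40) = d v (hd Q3) + d (hd Q3) (P ! x 40)" using Q3(4) hds(3) by blast+
  have z1: "j < x 3" if "j \<in> {x 0..x 40}" "adj G (hd Q1) (P ! j)" for j
    using zoneR[OF h1 d_adj[OF that(2)]] B_less[OF that(1)] by simp
  have z2: "Suc (x 17) \<le> j \<and> j < x 23" if "j \<in> {x 0..x 40}" "adj G (hd Q2) (P ! j)" for j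
    using zoneR[OF h2 d_adj[OF that(2)]] zoneL[OF h2 d_adj[OF that(2)]] B_less[OF that(1)] by (simp add: Suc_le_eq)
  have z3: "x 37 < j" if "j \<in> {x 0..x 40}" "adj G (hd Q3) (P ! j)" for j
    using zoneL[OF h3 d_adj[OF that(2)]] B_less[OF that(1)] by simp
  obtain j where j: "j \<in> {x 0..x 40}" "adj G (hd Q2) (P ! j)" using Q2(6) by (auto simp: B_def)
  have jz: "x 17 \<le> j" "j \<le> x 23" "j < length P" using z2[OF j] B_less[OF j(1)] by simp_all
  \<comment> \<open>Seventeen steps give \<open>17 \<le> 2 * d w (P ! j)\<close>, so
    \<open>d w (P ! j)\<close> is at least 9; passing to the neighbour \<open>hd Q2\<close> of
    \<open>P ! j\<close> costs at most 1.\<close>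
  have far: "6 \<le> d (hd Q2) w" if w: "w \<in> set Q1 \<union> set Q3" for w
  proof -
    have wV: "w \<in> verts G" using w Q1(4) Q3(4) by blast
    have "17 \<le> 2 * d w (P ! j)"
    proof (cases "w \<in> set Q1")
      case True
      then have "?f j + j \<le> ?f (x 0) + x 0 + 2 * d w (P ! j)"
        using geodesic_far(1)[OF P v wV _ xlen jz(3)] Q1(4) by simp
      then show ?thesis using lipschitz(1)[OF P v jz(1,3)] mono(1)[of 0 17] by simp
    next
      case False
      then have "?f j + x 40 \<le> ?f (x 40) + j + 2 * d w (P ! j)"
        using geodesic_far(2)[OF P v wV _ xlen jz(3)] Q3(4) w by simp
      then show ?thesis using lipschitz(2)[OF P v jz(2) xlen] mono(2)[of 23 40] by simp
    qed
    moreover have "d w (P ! j) \<le> d w (hd Q2) + d (hd Q2) (P ! j)"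
      using d_triangle[OF wV h2(1)] VP jz(3) by simp
    ultimately show ?thesis using d_adj[OF j(2)] d_sym[OF wV h2(1)] by linarith
  qed
  have QQ: "Q \<noteq> [] \<and> successively (adj G) Q \<and> last Q = v \<and> set Q \<subseteq> verts G"
    "hd Q \<notin> B \<and> (\<exists>b\<in>B. adj G (hd Q) b)"
    "z \<in> set (tl Q) \<Longrightarrow> z \<notin> B \<and> (\<forall>b\<in>B. \<not> adj G z b)" if "Q \<in> {Q1, Q2, Q3}" for Q z
    using that Q1 Q2 Q3 by blast+
  show ?thesis
  proof (rule web_if_three_legs[OF P len B_def QQ(1) _ _ z1 z2 z3 _ _ _ far])
    show "x 3 + 4 \<le> Suc (x 17)" "Suc (x 17) \<le> x 23" "x 23 + 4 \<le> x 37"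
      using mono(3)[of 3 17] mono(3)[of 17 23] mono(3)[of 23 37] by simp_all
  qed (use QQ in \<open>simp_all add: B_def\<close>)
qed

lemma web_if_large_ipco:
  assumes "40 < ipco G"
  shows "\<exists>H A B C H'. web (adj G) H A B C H' \<and> set (H @ A @ B @ C @ H') \<subseteq> verts G"
proof -
  obtain v where v: "v \<in> verts G" using connected by (auto simp: connected_def strongly_connected_def)
  obtain P x where "isometric_path G P" "x 40 < length P"
    "\<And>i. i < 40 \<Longrightarrow> skew (\<lambda>i. d v (P ! i)) (x i) (x (Suc i))"
    by (rule skew_sequence_if_less_ipco[OF assms v]) blast
  then show ?thesis using web_if_skew_sequence v by blast
qed

end

theorem theorem3:
  fixes G :: "('a, 'b) pre_digraph"
  assumes "Digraph.graph G" and "Digraph_Component.connected G"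
  shows "(\<forall>\<delta>::real. hyperbolic \<delta> G \<longrightarrow> real (ipco G) \<le> 4 * \<delta> + 3) \<and>
         (theta_pyramid_prism_free G \<longrightarrow> ipco G \<le> 71) \<and>
         (outerstring G \<longrightarrow> ipco G \<le> 95)"
proof -
  interpret connected_graph G
    using assms by (simp add: connected_graph_def connected_graph_axioms_def)
  have "\<not> theta_pyramid_prism_free G \<and> \<not> outerstring G" if large: "40 < ipco G"
  proof -
    obtain H A B C H' where web: "web (adj G) H A B C H'" "set (H @ A @ B @ C @ H') \<subseteq> verts G"
      using web_if_large_ipco[OF large] by blast
    then show ?thesis
      using web_imp_theta_pyramid_prism[OF assms(1) web]
        web_imp_not_outerstring[OF adj_symp[OF assms(1)] adj_irreflp[OF assms(1)] web] by simp
  qed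
  then have "ipco G \<le> 40" if "theta_pyramid_prism_free G \<or> outerstring G" using that by linarith
  then show ?thesis using ipco_le_if_hyperbolic by fastforce
qed

end
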